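(* Let $\mathbf{K}$ be an associative, not necessarily commutative, ring with division by integers and let $n\ge1$. For $n\times n$ matrices $A$ over $\mathbf{K}$: (a) $edet(A)$ is a polyadditive function of the rows and of the columns of $A$ (additive in each row when the other rows are fixed, and additive in each column when the other columns are fixed); (b) $edet(A)$ is an antisymmetric function of the rows and of the columns of $A$ (interchanging two distinct rows, or two distinct columns, changes $edet(A)$ to $-edet(A)$); (c) $edet(A)=0$ if $A$ contains a zero row or a zero column; (d) $edet(A)=0$ if $A$ contains two equal rows or two equal columns; (e) $edet(A)=edet(A^T)$. Moreover, the Laplace expansion formulas and the formula $edet(AB)=edet(A)\,edet(B)$ are not valid in general: they do not hold for all such rings $\mathbf{K}$, all $n$, and all $n\times n$ matrices.
   Context: A ring is "with division by integers" if for every nonzero integer $m$ the map $x\mapsto mx$ is bijective on the ring; $\frac1m x$ denotes the inverse image of $x$. Rings are not assumed to have a unit. For $A=(a_{ij})$ an $n\times n$ matrix over $\mathbf{K}$, define $$edet(A)=\frac{-1}{n!}\Big\{\sum_{l\in L_{n-1}^{(e)}}su(l)^n-\sum_{l\in L_{n-1}^{(o)}}su(l)^n+\sum_{l\in L_n^{(o)}}su(l)^n-\sum_{l\in L_n^{(e)}}su(l)^n\Big\}.$$ Here $S_n^{(e)}$, $S_n^{(o)}$ are the sets of even and odd permutations of $\{1,\dots,n\}$. For a permutation $\sigma$ and $1\le i_1<\dots<i_k\le n$, the sequence $l=(a_{i_1\sigma(i_1)},\dots,a_{i_k\sigma(i_k)})$ is a subdiagonal of length $k$ of the diagonal $(a_{1\sigma(1)},\dots,a_{n\sigma(n)})$;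 subdiagonals are identified by their positions $\{(i_1,\sigma(i_1)),\dots,(i_k,\sigma(i_k))\}$ in the matrix (not merely by the values of the entries). $L_k^{(e)}$ (respectively $L_k^{(o)}$) is the set of all subdiagonals of length $k$ of diagonals with $\sigma\in S_n^{(e)}$ (respectively $\sigma\in S_n^{(o)}$), and $su(l)=\sum_{s=1}^k a_{i_s\sigma(i_s)}$. For $n=1$, $L_0^{(e)}$ consists of the empty subdiagonal, with $su=0$, and $L_0^{(o)}=\emptyset$. The Laplace expansion formulas are $edet(A)=\sum_{j=1}^n(-1)^{i+j}a_{ij}\,edet(A_{ij})$ (row $i$) and $edet(A)=\sum_{i=1}^n(-1)^{i+j}a_{ij}\,edet(A_{ij})$ (column $j$), where $n\ge2$ and $A_{ij}$ is $A$ with row $i$ and column $j$ deleted. *)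

theory Defs
  imports "HOL-Algebra.Ring" "HOL-Combinatorics.Permutations" "Jordan_Normal_Form.Determinant"
begin

text \<open>
  The library's \<^locale>\<open>ring\<close> demands a unit. Here the \<open>one\<close> field of the record is
  never constrained and never used.
\<close>

locale nonunital_ring = abelian_group R for R (structure) +
  assumes m_closed: "\<lbrakk>x \<in> carrier R; y \<in> carrier R\<rbrakk> \<Longrightarrow> x \<otimes> y \<in> carrier R"
    and m_assoc: "\<lbrakk>x \<in> carrier R; y \<in> carrier R; z \<in> carrier R\<rbrakk>
      \<Longrightarrow> (x \<otimes> y) \<otimes> z = x \<otimes> (y \<otimes> z)"
    and l_distr: "\<lbrakk>x \<in> carrier R; y \<in> carrier R; z \<in> carrier R\<rbrakk>
      \<Longrightarrow> (x \<oplus> y) \<otimes> z = x \<otimes> z \<oplus> y \<otimes> z"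
    and r_distr: "\<lbrakk>x \<in> carrier R; y \<in> carrier R; z \<in> carrier R\<rbrakk>
      \<Longrightarrow> z \<otimes> (x \<oplus> y) = z \<otimes> x \<oplus> z \<otimes> y"

definition division_by_integers :: "('a, 'm) ring_scheme \<Rightarrow> bool" where
  "division_by_integers K \<longleftrightarrow>
     (\<forall>m::int. m \<noteq> 0 \<longrightarrow> bij_betw (\<lambda>x. [m] \<cdot>\<^bsub>K\<^esub> x) (carrier K) (carrier K))"

definition int_divide :: "('a, 'm) ring_scheme \<Rightarrow> int \<Rightarrow> 'a \<Rightarrow> 'a" where
  "int_divide K m x = inv_into (carrier K) (\<lambda>y. [m] \<cdot>\<^bsub>K\<^esub> y) x"

text \<open>
  The power \<open>x\<^sup>n\<close> without a unit, meaningful for \<open>n \<ge> 1\<close> only. The library's \<open>[^]\<close> starts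
  from \<open>one\<close> and is therefore unsuitable.
\<close>

definition pos_power :: "('a, 'm) ring_scheme \<Rightarrow> 'a \<Rightarrow> nat \<Rightarrow> 'a" where
  "pos_power K x n = ((\<lambda>y. y \<otimes>\<^bsub>K\<^esub> x) ^^ (n - 1)) x"

text \<open>
  Matrices are indexed from 0; the signs \<open>(-1)\<^sup>i\<^sup>+\<^sup>j\<close> and the parity of permutations
  are the same as for indices starting from 1.
\<close>

definition matrices_over :: "('a, 'm) ring_scheme \<Rightarrow> nat \<Rightarrow> 'a mat set" where
  "matrices_over K n = {A \<in> carrier_mat n n. \<forall>i<n. \<forall>j<n. A $$ (i, j) \<in> carrier K}"

text \<open>
  A subdiagonal is represented by its set of positions. The Boolean argument selects the
  parity: \<open>subdiagonals True n k\<close> is \<open>L\<^sub>k\<close> for even permutations, \<open>subdiagonals False n k\<close>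
  for odd ones.
\<close>

definition subdiagonals :: "bool \<Rightarrow> nat \<Rightarrow> nat \<Rightarrow> (nat \<times> nat) set set" where
  "subdiagonals even_parity n k =
     {(\<lambda>i. (i, \<sigma> i)) ` I | \<sigma> I.
        \<sigma> permutes {..<n} \<and> evenperm \<sigma> = even_parity \<and> I \<subseteq> {..<n} \<and> card I = k}"

definition su :: "('a, 'm) ring_scheme \<Rightarrow> 'a mat \<Rightarrow> (nat \<times> nat) set \<Rightarrow> 'a" where
  "su K A l = (\<Oplus>\<^bsub>K\<^esub>p\<in>l. A $$ p)"

definition edet :: "('a, 'm) ring_scheme \<Rightarrow> 'a mat \<Rightarrow> 'a" where
  "edet K A =
     (let n = dim_row A;
          S = (\<lambda>even_parity k. \<Oplus>\<^bsub>K\<^esub>l\<in>subdiagonals even_parity n k. pos_power K (su K A l) n)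
      in \<ominus>\<^bsub>K\<^esub> int_divide K (fact n)
           (S True (n - 1) \<ominus>\<^bsub>K\<^esub> S False (n - 1) \<oplus>\<^bsub>K\<^esub> S False n \<ominus>\<^bsub>K\<^esub> S True n))"

definition laplace_row :: "('a, 'm) ring_scheme \<Rightarrow> 'a mat \<Rightarrow> nat \<Rightarrow> 'a" where
  "laplace_row K A i =
     (\<Oplus>\<^bsub>K\<^esub>j\<in>{..<dim_col A}.
        [((- 1 :: int) ^ (i + j))] \<cdot>\<^bsub>K\<^esub> (A $$ (i, j) \<otimes>\<^bsub>K\<^esub> edet K (mat_delete A i j)))"

definition laplace_col :: "('a, 'm) ring_scheme \<Rightarrow> 'a mat \<Rightarrow> nat \<Rightarrow> 'a" where
  "laplace_col K A j =
     (\<Oplus>\<^bsub>K\<^esub>i\<in>{..<dim_row A}.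
        [((- 1 :: int) ^ (i + j))] \<cdot>\<^bsub>K\<^esub> (A $$ (i, j) \<otimes>\<^bsub>K\<^esub> edet K (mat_delete A i j)))"

text \<open>The library's matrix product is tied to type-class operations.\<close>

definition mat_product :: "('a, 'm) ring_scheme \<Rightarrow> 'a mat \<Rightarrow> 'a mat \<Rightarrow> 'a mat" where
  "mat_product K A B =
     mat (dim_row A) (dim_col B)
       (\<lambda>(i, j). \<Oplus>\<^bsub>K\<^esub>k\<in>{..<dim_col A}. A $$ (i, k) \<otimes>\<^bsub>K\<^esub> B $$ (k, j))"

end

theory Submission
  imports Defs "HOL-Library.Countable" "HOL-Library.Product_Plus"
begin

text \<open>
  Expand every power \<open>su(l)\<^sup>n\<close> into words of length \<open>n\<close>. The words taken from the diagonals
  that miss at least two rows cancel between permutations differing by a transposition of two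
  missed rows, and those that miss exactly one row cancel between the lengths \<open>n - 1\<close> and \<open>n\<close>.
  What remains is \<open>n! edet(A) = \<Sum>\<^sub>\<tau> \<Sum>\<^sub>\<rho> sgn \<tau> sgn \<rho> a\<^bsub>\<tau>(1)\<rho>(1)\<^esub> \<dots> a\<^bsub>\<tau>(n)\<rho>(n)\<^esub>\<close>,
  from which all the positive statements are read off; those about columns follow by transposition.

  For the negative ones, \<open>2 edet(diag(x, y)) = xy + yx\<close>, whereas the Laplace expansion gives
  \<open>xy\<close>, and multiplicativity on \<open>diag(1, y)\<close>, \<open>diag(x, 1)\<close> would give \<open>yx\<close>. So every formula
  fails over a noncommutative ring with unit, such as the upper triangular rational matrices.
\<close>

section \<open>Words and powers of sums\<close>

text \<open>\<open>word_prod K x m\<close> has the \<open>m + 1\<close> factors \<open>x 0, \<dots>, x m\<close>, as there is no empty product.\<close>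

primrec word_prod :: "('a, 'm) ring_scheme \<Rightarrow> (nat \<Rightarrow> 'a) \<Rightarrow> nat \<Rightarrow> 'a" where
  "word_prod K x 0 = x 0"
| "word_prod K x (Suc m) = word_prod K x m \<otimes>\<^bsub>K\<^esub> x (Suc m)"

lemma pos_power_eq_word_prod: "pos_power K x (Suc m) = word_prod K (\<lambda>_. x) m"
  by (induction m) (simp_all add: pos_power_def)

lemma word_prod_cong: "(\<And>k. k \<le> m \<Longrightarrow> x k = y k) \<Longrightarrow> word_prod K x m = word_prod K y m"
  by (induction m) simp_all

section \<open>Finite sums in an abelian group\<close>

context abelian_group
begin

lemma finsum_Times:
  assumes "finite I" "finite J" and f: "\<And>i j. i \<in> I \<Longrightarrow> j \<in> J \<Longrightarrow> f (i, j) \<in> carrier G"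
  shows "(\<Oplus>p\<in>I \<times> J. f p) = (\<Oplus>i\<in>I. \<Oplus>j\<in>J. f (i, j))"
  using assms(1) f
proof (induction I rule: finite_induct)
  case (insert a I)
  have "(\<Oplus>p\<in>insert a I \<times> J. f p) = (\<Oplus>p\<in>Pair a ` J. f p) \<oplus> (\<Oplus>p\<in>I \<times> J. f p)"
    by (subst finsum_Un_disjoint[symmetric])
       (use insert \<open>finite J\<close> in \<open>auto intro: arg_cong[where f = "finsum G f"]\<close>)
  also have "(\<Oplus>p\<in>Pair a ` J. f p) = (\<Oplus>j\<in>J. f (a, j))"
    by (rule finsum_reindex) (use insert in \<open>auto simp: inj_on_def\<close>)
  finally show ?case
    using insert by (simp add: Pi_iff)
qed simp

lemma finsum_swap:
  assumes "finite I" "finite J" "\<And>i j. i \<in> I \<Longrightarrow> j \<in> J \<Longrightarrow> f i j \<in> carrier G"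
  shows "(\<Oplus>i\<in>I. \<Oplus>j\<in>J. f i j) = (\<Oplus>j\<in>J. \<Oplus>i\<in>I. f i j)"
  using assms(1,3)
proof (induction I rule: finite_induct)
  case (insert a I)
  have "(\<Oplus>j\<in>J. \<Oplus>i\<in>insert a I. f i j) = (\<Oplus>j\<in>J. f a j \<oplus> (\<Oplus>i\<in>I. f i j))"
    using insert by (intro finsum_cong') (auto simp: Pi_iff)
  then show ?case
    using insert by (simp add: Pi_iff)
qed simp

lemma int_smult_finsum:
  assumes "f \<in> I \<rightarrow> carrier G"
  shows "[(m::int)] \<cdot> (\<Oplus>i\<in>I. f i) = (\<Oplus>i\<in>I. [m] \<cdot> f i)"
  using assms
  by (induction I rule: infinite_finite_induct) (simp_all add: Pi_iff add.int_pow_distrib)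

lemma finsum_a_inv:
  assumes "f \<in> I \<rightarrow> carrier G"
  shows "(\<Oplus>i\<in>I. \<ominus> f i) = \<ominus> (\<Oplus>i\<in>I. f i)"
  using int_smult_finsum[OF assms, of "-1"] assms
  by (simp add: add.int_pow_neg Pi_iff cong: finsum_cong)

end

section \<open>Distributivity and expansion of words in a ring without unit\<close>

context nonunital_ring
begin

lemma l_null: "x \<in> carrier R \<Longrightarrow> \<zero> \<otimes> x = \<zero>"
  by (metis add.l_cancel_one' l_distr m_closed zero_closed l_zero)

lemma r_null: "x \<in> carrier R \<Longrightarrow> x \<otimes> \<zero> = \<zero>"
  by (metis add.l_cancel_one' r_distr m_closed zero_closed l_zero)

lemma finsum_rdistr:
  assumes "x \<in> carrier R" "f \<in> I \<rightarrow> carrier R"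
  shows "x \<otimes> (\<Oplus>i\<in>I. f i) = (\<Oplus>i\<in>I. x \<otimes> f i)"
  using assms(2)
  by (induction I rule: infinite_finite_induct)
     (simp_all add: assms(1) Pi_iff r_distr m_closed r_null)

lemma finsum_ldistr:
  assumes "x \<in> carrier R" "f \<in> I \<rightarrow> carrier R"
  shows "(\<Oplus>i\<in>I. f i) \<otimes> x = (\<Oplus>i\<in>I. f i \<otimes> x)"
  using assms(2)
  by (induction I rule: infinite_finite_induct)
     (simp_all add: assms(1) Pi_iff l_distr m_closed l_null)

lemma word_prod_closed: "(\<And>k. k \<le> m \<Longrightarrow> x k \<in> carrier R) \<Longrightarrow> word_prod R x m \<in> carrier R"
  by (induction m) (simp_all add: m_closed)

text \<open>Distributivity at the factor \<open>r\<close>: from the left if it is the last one,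
  otherwise from the right after the induction. This is the source of polyadditivity.\<close>

lemma word_prod_add:
  assumes "r \<le> m" "z r = x r \<oplus> y r"
    and "\<And>k. k \<le> m \<Longrightarrow> x k \<in> carrier R" "\<And>k. k \<le> m \<Longrightarrow> y k \<in> carrier R"
    and "\<And>k. k \<le> m \<Longrightarrow> k \<noteq> r \<Longrightarrow> x k = z k \<and> y k = z k"
  shows "word_prod R z m = word_prod R x m \<oplus> word_prod R y m"
  using assms
proof (induction m)
  case (Suc m)
  have closed: "word_prod R x m \<in> carrier R" "word_prod R y m \<in> carrier R"
    using Suc.prems by (auto intro!: word_prod_closed)
  show ?case
  proof (cases "r = Suc m")
    case True
    then have "word_prod R x m = word_prod R z m" "word_prod R y m = word_prod R z m"
      using Suc.prems by (auto intro!: word_prod_cong)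
    then show ?thesis
      using closed Suc.prems True by (simp add: r_distr)
  next
    case False
    then have "word_prod R z m = word_prod R x m \<oplus> word_prod R y m"
      using Suc.prems by (intro Suc.IH) auto
    moreover have "x (Suc m) = z (Suc m)" "y (Suc m) = z (Suc m)" "x (Suc m) \<in> carrier R"
      using Suc.prems(5)[of "Suc m"] Suc.prems(3)[of "Suc m"] False by auto
    ultimately show ?thesis
      using closed by (simp add: l_distr)
  qed
qed simp

text \<open>Noncommutative multinomial expansion: each factor chooses its summand independently.
  Extensional functions make every choice occur exactly once.\<close>

lemma word_prod_finsum:
  assumes "finite I" "x \<in> I \<rightarrow> carrier R"
  shows "word_prod R (\<lambda>_. \<Oplus>i\<in>I. x i) m = (\<Oplus>f\<in>{..m} \<rightarrow>\<^sub>E I. word_prod R (\<lambda>k. x (f k)) m)"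
proof (induction m)
  case 0
  have inj: "inj_on (\<lambda>i. \<lambda>k\<in>{..0::nat}. i) I"
    by (rule inj_onI) (metis atMost_iff le_refl restrict_apply')
  have "{..0::nat} \<rightarrow>\<^sub>E I = (\<lambda>i. \<lambda>k\<in>{..0::nat}. i) ` I"
  proof safe
    fix f assume "f \<in> {..0::nat} \<rightarrow>\<^sub>E I"
    then show "f \<in> (\<lambda>i. \<lambda>k\<in>{..0::nat}. i) ` I"
      by (intro image_eqI[of _ _ "f 0"] extensionalityI[of _ "{..0}"]) (auto simp: PiE_def)
  qed (auto split: if_splits)
  then show ?case
    using assms finsum_reindex[OF _ inj, of "\<lambda>f. x (f 0)"] by (auto simp: Pi_iff cong: finsum_cong)
next
  case (Suc m)
  let ?E = "{..m} \<rightarrow>\<^sub>E I"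
  \<comment> \<open>\<open>?h\<close> appends the letter \<open>i\<close> to the word
    \<open>f\<close> at the new position \<open>Suc m\<close>.\<close>
  let ?h = "\<lambda>(f, i). f(Suc m := i)"
  have fin: "finite ?E"
    using assms by (intro finite_PiE) auto
  have W: "word_prod R (\<lambda>k. x (f k)) m \<in> carrier R" if "f \<in> ?E" for f
    using that assms by (intro word_prod_closed) (auto simp: PiE_def Pi_iff)
  have img: "{..Suc m} \<rightarrow>\<^sub>E I = ?h ` (?E \<times> I)"
    unfolding atMost_Suc PiE_insert_eq by (auto simp: image_iff)
  have inj: "inj_on ?h (?E \<times> I)"
  proof (rule inj_onI; clarify)
    fix f i g j assume *: "f \<in> ?E" "g \<in> ?E" "f(Suc m := i) = g(Suc m := j)"
    \<comment> \<open>At \<open>Suc m\<close> both functions are \<open>undefined\<close>, being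
      extensional on \<open>{..m}\<close>; elsewhere the update does not interfere.\<close>
    then have "f k = g k" for k
      by (cases "k = Suc m") (auto simp: PiE_def extensional_def fun_upd_def dest: fun_cong[of _ _ k])
    then show "f = g \<and> i = j"
      using * by (auto dest: fun_cong[of _ _ "Suc m"])
  qed
  have "word_prod R (\<lambda>_. \<Oplus>i\<in>I. x i) (Suc m)
      = (\<Oplus>f\<in>?E. word_prod R (\<lambda>k. x (f k)) m) \<otimes> (\<Oplus>i\<in>I. x i)"
    using Suc by simp
  also have "\<dots> = (\<Oplus>f\<in>?E. word_prod R (\<lambda>k. x (f k)) m \<otimes> (\<Oplus>i\<in>I. x i))"
    using assms W by (intro finsum_ldistr) auto
  also have "\<dots> = (\<Oplus>f\<in>?E. \<Oplus>i\<in>I. word_prod R (\<lambda>k. x (f k)) m \<otimes> x i)"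
    using assms W by (intro finsum_cong' finsum_rdistr) (auto intro!: finsum_closed m_closed)
  also have "\<dots> = (\<Oplus>p\<in>?E \<times> I. word_prod R (\<lambda>k. x (fst p k)) m \<otimes> x (snd p))"
    using assms W fin by (subst finsum_Times) (auto intro!: m_closed)
  also have "\<dots> = (\<Oplus>p\<in>?E \<times> I. word_prod R (\<lambda>k. x (?h p k)) (Suc m))"
  proof (intro finsum_cong')
    fix p assume p: "p \<in> ?E \<times> I"
    have "word_prod R (\<lambda>k. x (fst p k)) m = word_prod R (\<lambda>k. x (?h p k)) m"
      by (intro word_prod_cong) (auto simp: case_prod_beta)
    then show "word_prod R (\<lambda>k. x (fst p k)) m \<otimes> x (snd p) = word_prod R (\<lambda>k. x (?h p k)) (Suc m)"
      by (simp add: case_prod_beta)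
  next
    show "(\<lambda>p. word_prod R (\<lambda>k. x (?h p k)) (Suc m)) \<in> ?E \<times> I \<rightarrow> carrier R"
      using assms by (intro funcsetI word_prod_closed) (auto simp: PiE_def Pi_iff)
  qed simp
  also have "\<dots> = (\<Oplus>f\<in>?h ` (?E \<times> I). word_prod R (\<lambda>k. x (f k)) (Suc m))"
    by (rule finsum_reindex[symmetric, OF _ inj], unfold img[symmetric])
       (use assms in \<open>auto intro!: m_closed word_prod_closed simp: PiE_def Pi_iff\<close>)
  finally show ?case
    using img by simp
qed

end

section \<open>Cancellation of words\<close>

lemma transpose_permutes: "i < n \<Longrightarrow> j < n \<Longrightarrow> transpose i j permutes {..<n::nat}"
  by (simp add: permutes_swap_id)

lemma sign_comp_permutes:
  "p permutes {..<n::nat} \<Longrightarrow> q permutes {..<n} \<Longrightarrow> sign (p \<circ> q) = sign p * sign q"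
  by (intro sign_compose permutes_imp_permutation[OF finite_lessThan])

lemma image_comp_permutes_right:
  assumes "p permutes S"
  shows "(\<lambda>\<sigma>. \<sigma> \<circ> p) ` {\<sigma>. \<sigma> permutes S} = {\<sigma>. \<sigma> permutes S}"
proof (intro equalityI subsetI)
  fix \<sigma> assume "\<sigma> \<in> {\<sigma>. \<sigma> permutes S}"
  then show "\<sigma> \<in> (\<lambda>\<sigma>. \<sigma> \<circ> p) ` {\<sigma>. \<sigma> permutes S}"
    using assms
    by (intro image_eqI[of _ _ "\<sigma> \<circ> inv_into UNIV p"])
       (auto simp: o_assoc[symmetric] permutes_inv_o intro: permutes_compose permutes_inv)
qed (use assms in \<open>auto intro: permutes_compose\<close>)

lemma inj_on_comp_permutes_right: "p permutes S \<Longrightarrow> inj_on (\<lambda>\<sigma>. \<sigma> \<circ> p) T"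
  by (rule inj_onI) (metis comp_id o_assoc permutes_inv_o(1))

lemma image_comp_permutes_left:
  assumes "p permutes S"
  shows "(\<lambda>\<sigma>. p \<circ> \<sigma>) ` {\<sigma>. \<sigma> permutes S} = {\<sigma>. \<sigma> permutes S}"
proof (intro equalityI subsetI)
  fix \<sigma> assume "\<sigma> \<in> {\<sigma>. \<sigma> permutes S}"
  then show "\<sigma> \<in> (\<lambda>\<sigma>. p \<circ> \<sigma>) ` {\<sigma>. \<sigma> permutes S}"
    using assms
    by (intro image_eqI[of _ _ "inv_into UNIV p \<circ> \<sigma>"])
       (auto simp: o_assoc permutes_inv_o intro: permutes_compose permutes_inv)
qed (use assms in \<open>auto intro: permutes_compose\<close>)

lemma inj_on_comp_permutes_left: "p permutes S \<Longrightarrow> inj_on (\<lambda>\<sigma>. p \<circ> \<sigma>) T"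
  by (rule inj_onI) (metis id_comp o_assoc permutes_inv_o(2))

lemma matrices_over_entry:
  "A \<in> matrices_over K n \<Longrightarrow> i < n \<Longrightarrow> j < n \<Longrightarrow> A $$ (i, j) \<in> carrier K"
  by (simp add: matrices_over_def)

lemma graph_on_eq_imp:
  assumes "(\<lambda>i. (i, \<sigma> i)) ` I = (\<lambda>i. (i, \<tau> i)) ` J"
  shows "I = J" and "i \<in> I \<Longrightarrow> \<sigma> i = \<tau> i"
  using assms by (auto simp: set_eq_iff image_iff)

text \<open>The permutation \<open>\<tau>\<close>-inverse after \<open>\<sigma>\<close> fixes every
  point other than \<open>j\<close>, and injectivity leaves only \<open>j\<close> itself as its
  value at \<open>j\<close>.\<close>

lemma permutes_eqI_except:
  assumes "\<sigma> permutes S" "\<tau> permutes S" "\<And>i. i \<in> S \<Longrightarrow> i \<noteq> j \<Longrightarrow> \<sigma> i = \<tau> i"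
  shows "\<sigma> = \<tau>"
proof
  have *: "(inv_into UNIV \<tau> \<circ> \<sigma>) i = i" if "i \<noteq> j" for i
    using that assms by (cases "i \<in> S") (auto simp: permutes_inverses permutes_not_in[OF permutes_inv] permutes_not_in)
  have "inj (inv_into UNIV \<tau> \<circ> \<sigma>)"
    using assms by (metis inj_compose permutes_inj permutes_inv)
  then have "(inv_into UNIV \<tau> \<circ> \<sigma>) j = j"
    using * by (metis injD)
  then show "\<sigma> i = \<tau> i" for i
    using * assms(2) by (metis comp_apply permutes_inverses(1))
qed

text \<open>The positions determine the rows \<open>I\<close> and the values of
  \<open>\<sigma>\<close> on them, and at most one value is missing, so it is forced. With two rows
  missing, two permutations could share a subdiagonal. This lets sums over position sets be taken
  over pairs of a permutation and a row set.\<close>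

lemma inj_on_graph:
  fixes m :: nat
  assumes "k = m \<or> k = Suc m"
  shows "inj_on (\<lambda>(\<sigma>, I). (\<lambda>i. (i, \<sigma> i)) ` I)
           ({\<sigma>. \<sigma> permutes {..<Suc m}} \<times> {I. I \<subseteq> {..m} \<and> card I = k})"
proof (rule inj_onI; clarify)
  fix \<sigma> \<tau> :: "nat \<Rightarrow> nat" and I J :: "nat set"
  assume *: "\<sigma> permutes {..<Suc m}" "\<tau> permutes {..<Suc m}" "I \<subseteq> {..m}" "k = card I"
    and eq: "(\<lambda>i. (i, \<sigma> i)) ` I = (\<lambda>i. (i, \<tau> i)) ` J"
  have "card ({..m} - I) \<le> 1"
    using * assms by (subst card_Diff_subset) (auto intro: finite_subset)
  then have "is_singleton ({..m} - I) \<or> {..m} - I = {}"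
    by (auto simp: le_Suc_eq is_singleton_altdef card_eq_0_iff)
  \<comment> \<open>\<open>j\<close> is the missing row, or arbitrary if \<open>I\<close> contains
    all rows.\<close>
  then obtain j where j: "{..m} - I \<subseteq> {j}"
    by (auto simp: is_singleton_def)
  have "\<sigma> = \<tau>"
  proof (rule permutes_eqI_except[OF *(1,2), of j])
    fix i assume "i \<in> {..<Suc m}" "i \<noteq> j"
    then have "i \<in> I" using j by (auto simp: less_Suc_eq_le)
    then show "\<sigma> i = \<tau> i" by (rule graph_on_eq_imp(2)[OF eq])
  qed
  with graph_on_eq_imp(1)[OF eq] show "\<sigma> = \<tau> \<and> I = J" by simp
qed

section \<open>Rings with division by integers and the expansion of the alternating power
  sums\<close>

locale divisible_ring = nonunital_ring +
  assumes division: "division_by_integers R"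
begin

lemma int_smult_cancel:
  assumes "m \<noteq> 0" "x \<in> carrier R" "y \<in> carrier R" "[(m::int)] \<cdot> x = [m] \<cdot> y"
  shows "x = y"
  using division assms unfolding division_by_integers_def by (meson bij_betw_inv_into_left bij_betw_def inj_onD)

lemma int_divide_closed: "m \<noteq> 0 \<Longrightarrow> x \<in> carrier R \<Longrightarrow> int_divide R m x \<in> carrier R"
  using division unfolding division_by_integers_def int_divide_def
  by (metis bij_betw_imp_surj_on inv_into_into)

lemma int_smult_int_divide: "m \<noteq> 0 \<Longrightarrow> x \<in> carrier R \<Longrightarrow> [m] \<cdot> int_divide R m x = x"
  using division unfolding division_by_integers_def int_divide_def
  by (metis (mono_tags, lifting) bij_betw_inv_into_right)

text \<open>The hypothesis gives \<open>2x = 0\<close>, and doubling is injective. Every passage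
  from antisymmetry to vanishing goes through this.\<close>

lemma eq_a_inv_self_imp_zero:
  assumes "x \<in> carrier R" "x = \<ominus> x"
  shows "x = \<zero>"
proof -
  have "[(2::int)] \<cdot> x = x \<oplus> x"
    using add.int_pow_mult[OF assms(1), of 1 1] assms(1) by simp
  also have "\<dots> = \<zero>"
    using assms by (metis r_neg)
  finally show ?thesis
    using assms(1) by (intro int_smult_cancel[of 2 x \<zero>, rotated -1]) auto
qed

text \<open>One term in the expansion of a power of \<open>su\<close>: \<open>f\<close> lists the
  rows of the letters, possibly with repetitions, and all letters lie on the diagonal of
  \<open>\<sigma>\<close>.\<close>

definition diagonal_word :: "'a mat \<Rightarrow> nat \<Rightarrow> (nat \<Rightarrow> nat) \<Rightarrow> (nat \<Rightarrow> nat) \<Rightarrow> 'a" where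
  "diagonal_word A m f \<sigma> = word_prod R (\<lambda>k. A $$ (f k, \<sigma> (f k))) m"

text \<open>The row pattern \<open>f\<close> is held fixed while the diagonal varies; the
  cancellations take place inside this sum.\<close>

definition alternating_sum :: "'a mat \<Rightarrow> nat \<Rightarrow> (nat \<Rightarrow> nat) \<Rightarrow> 'a" where
  "alternating_sum A m f =
     (\<Oplus>\<sigma>\<in>{\<sigma>. \<sigma> permutes {..<Suc m}}. [sign \<sigma>] \<cdot> diagonal_word A m f \<sigma>)"

context
  fixes A m
  assumes A: "A \<in> matrices_over R (Suc m)"
begin

lemma diagonal_word_closed:
  assumes "\<sigma> permutes {..<Suc m}" "f \<in> {..m} \<rightarrow> {..m}"
  shows "diagonal_word A m f \<sigma> \<in> carrier R"
proof -
  have "\<sigma> (f k) \<in> {..<Suc m}" if "k \<le> m" for k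
    using that assms by (subst permutes_in_image[OF assms(1)]) (auto simp: Pi_iff less_Suc_eq_le)
  then show ?thesis
    unfolding diagonal_word_def using assms(2)
    by (intro word_prod_closed matrices_over_entry[OF A]) (auto simp: Pi_iff less_Suc_eq_le)
qed

lemma alternating_sum_closed: "f \<in> {..m} \<rightarrow> {..m} \<Longrightarrow> alternating_sum A m f \<in> carrier R"
  unfolding alternating_sum_def by (auto intro!: finsum_closed diagonal_word_closed add.int_pow_closed)

text \<open>Interchanging the values of \<open>\<sigma>\<close> at two rows that do not occur in the word leaves the
  word unchanged and flips the sign.\<close>

lemma alternating_sum_eq_zero:
  assumes f: "f \<in> {..m} \<rightarrow> {..m}" and ij: "i \<le> m" "j \<le> m" "i \<noteq> j" "i \<notin> f ` {..m}" "j \<notin> f ` {..m}"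
  shows "alternating_sum A m f = \<zero>"
proof (rule eq_a_inv_self_imp_zero)
  let ?P = "{\<sigma>. \<sigma> permutes {..<Suc m}}"
  let ?t = "transpose i j"
  have t: "?t permutes {..<Suc m}"
    using ij by (intro transpose_permutes) auto
  have closed: "[sign \<sigma>] \<cdot> diagonal_word A m f \<sigma> \<in> carrier R" if "\<sigma> \<in> ?P" for \<sigma>
    using that f by (auto intro!: diagonal_word_closed add.int_pow_closed)
  have word: "diagonal_word A m f (\<sigma> \<circ> ?t) = diagonal_word A m f \<sigma>" for \<sigma>
    unfolding diagonal_word_def
    by (intro word_prod_cong) (use ij in \<open>auto simp: transpose_def\<close>)
  \<comment> \<open>Reindexing along \<open>\<sigma> \<mapsto> \<sigma> \<circ> ?t\<close>: the
    index set is first written as its own image under this translation.\<close>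
  have "alternating_sum A m f = (\<Oplus>\<sigma>\<in>?P. [sign (\<sigma> \<circ> ?t)] \<cdot> diagonal_word A m f (\<sigma> \<circ> ?t))"
    unfolding alternating_sum_def
    by (subst image_comp_permutes_right[OF t, symmetric], rule finsum_reindex,
        unfold image_comp_permutes_right[OF t])
       (use closed inj_on_comp_permutes_right[OF t] in auto)
  also have "\<dots> = (\<Oplus>\<sigma>\<in>?P. \<ominus> ([sign \<sigma>] \<cdot> diagonal_word A m f \<sigma>))"
    using closed f ij
    by (intro finsum_cong')
       (auto simp: word sign_comp_permutes[OF _ t] sign_swap_id add.int_pow_neg diagonal_word_closed)
  also have "\<dots> = \<ominus> alternating_sum A m f"
    unfolding alternating_sum_def using closed by (intro finsum_a_inv) auto
  finally show "alternating_sum A m f = \<ominus> alternating_sum A m f" .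
qed (use f in \<open>rule alternating_sum_closed\<close>)

text \<open>Rows index the positions injectively, so \<open>su\<close> is a sum over
  \<open>I\<close>, to which the multinomial expansion applies; the exponent \<open>Suc m\<close>
  gives letters numbered by \<open>{..m}\<close>.\<close>

lemma su_power:
  assumes \<sigma>: "\<sigma> permutes {..<Suc m}" and I: "I \<subseteq> {..m}"
  shows "pos_power R (su R A ((\<lambda>i. (i, \<sigma> i)) ` I)) (Suc m)
       = (\<Oplus>f\<in>{..m} \<rightarrow>\<^sub>E I. diagonal_word A m f \<sigma>)"
proof -
  have closed: "A $$ (i, \<sigma> i) \<in> carrier R" if "i \<in> I" for i
  proof -
    have "\<sigma> i \<in> {..<Suc m}"
      using that I by (subst permutes_in_image[OF \<sigma>]) auto
    then show ?thesis
      using that I by (intro matrices_over_entry[OF A]) auto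
  qed
  have "su R A ((\<lambda>i. (i, \<sigma> i)) ` I) = (\<Oplus>i\<in>I. A $$ (i, \<sigma> i))"
    unfolding su_def by (rule finsum_reindex) (use closed in \<open>auto simp: inj_on_def\<close>)
  then show ?thesis
    using closed finite_subset[OF I]
    by (simp add: pos_power_eq_word_prod word_prod_finsum diagonal_word_def Pi_iff)
qed

text \<open>By \<open>inj_on_graph\<close>, for these two lengths each subdiagonal comes from
  exactly one pair \<open>(\<sigma>, I)\<close>, so nothing is counted twice.\<close>

lemma subdiagonal_sum:
  assumes k: "k = m \<or> k = Suc m"
  shows "(\<Oplus>l\<in>subdiagonals p (Suc m) k. pos_power R (su R A l) (Suc m))
       = (\<Oplus>\<sigma>\<in>{\<sigma>. \<sigma> permutes {..<Suc m} \<and> evenperm \<sigma> = p}.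
           \<Oplus>I\<in>{I. I \<subseteq> {..m} \<and> card I = k}. \<Oplus>f\<in>{..m} \<rightarrow>\<^sub>E I. diagonal_word A m f \<sigma>)"
proof -
  let ?P = "{\<sigma>. \<sigma> permutes {..<Suc m} \<and> evenperm \<sigma> = p}"
  let ?C = "{I. I \<subseteq> {..m} \<and> card I = k}"
  let ?g = "\<lambda>(\<sigma>, I). (\<lambda>i. (i, \<sigma> i)) ` I"
  let ?h = "\<lambda>l. pos_power R (su R A l) (Suc m)"
  have sub: "subdiagonals p (Suc m) k = ?g ` (?P \<times> ?C)"
    unfolding subdiagonals_def by (force simp: lessThan_Suc_atMost image_iff)
  have inj: "inj_on ?g (?P \<times> ?C)"
    by (rule inj_on_subset[OF inj_on_graph[OF k]]) auto
  have fin: "finite ?P" "finite ?C"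
    by (auto intro: finite_subset[OF _ finite_permutations[of "{..<Suc m}"]])
  have inner: "(\<Oplus>f\<in>{..m} \<rightarrow>\<^sub>E I. diagonal_word A m f \<sigma>) \<in> carrier R"
    if "\<sigma> \<in> ?P" "I \<in> ?C" for \<sigma> I
    using that by (intro finsum_closed funcsetI diagonal_word_closed) (auto simp: PiE_def Pi_iff)
  have h: "?h (?g (\<sigma>, I)) = (\<Oplus>f\<in>{..m} \<rightarrow>\<^sub>E I. diagonal_word A m f \<sigma>)"
    if "\<sigma> \<in> ?P" "I \<in> ?C" for \<sigma> I
    using that by (simp add: su_power)
  have closed: "?h (?g q) \<in> carrier R" if "q \<in> ?P \<times> ?C" for q
    using that h inner by (cases q) auto
  have "(\<Oplus>l\<in>?g ` (?P \<times> ?C). ?h l) = (\<Oplus>q\<in>?P \<times> ?C. ?h (?g q))"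
    by (rule finsum_reindex[OF _ inj]) (use closed in auto)
  also have "\<dots> = (\<Oplus>\<sigma>\<in>?P. \<Oplus>I\<in>?C. ?h (?g (\<sigma>, I)))"
    using fin closed by (intro finsum_Times) auto
  also have "\<dots> = (\<Oplus>\<sigma>\<in>?P. \<Oplus>I\<in>?C. \<Oplus>f\<in>{..m} \<rightarrow>\<^sub>E I. diagonal_word A m f \<sigma>)"
    using inner by (intro finsum_cong' h) (auto intro!: finsum_closed)
  finally show ?thesis
    unfolding sub .
qed

text \<open>The two parity classes merge into one sum over all permutations weighted by
  \<open>sign\<close>, and this sum is then moved inside those over \<open>I\<close> and
  \<open>f\<close>.\<close>

lemma subdiagonal_sum_diff:
  assumes k: "k = m \<or> k = Suc m"
  shows "(\<Oplus>l\<in>subdiagonals True (Suc m) k. pos_power R (su R A l) (Suc m)) \<ominus>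
         (\<Oplus>l\<in>subdiagonals False (Suc m) k. pos_power R (su R A l) (Suc m))
       = (\<Oplus>I\<in>{I. I \<subseteq> {..m} \<and> card I = k}. \<Oplus>f\<in>{..m} \<rightarrow>\<^sub>E I. alternating_sum A m f)"
proof -
  let ?P = "{\<sigma>. \<sigma> permutes {..<Suc m}}"
  let ?Pp = "\<lambda>p. {\<sigma>. \<sigma> permutes {..<Suc m} \<and> evenperm \<sigma> = p}"
  let ?C = "{I. I \<subseteq> {..m} \<and> card I = k}"
  define Q where "Q \<sigma> = (\<Oplus>I\<in>?C. \<Oplus>f\<in>{..m} \<rightarrow>\<^sub>E I. diagonal_word A m f \<sigma>)" for \<sigma>
  have fin: "finite ?P" "finite ?C" "finite (?Pp p)" "I \<in> ?C \<Longrightarrow> finite ({..m} \<rightarrow>\<^sub>E I)" for p I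
    by (auto intro: finite_subset[OF _ finite_permutations[of "{..<Suc m}"]] finite_permutations
          finite_PiE dest: finite_subset)
  have word: "diagonal_word A m f \<sigma> \<in> carrier R" if "\<sigma> \<in> ?P" "I \<in> ?C" "f \<in> {..m} \<rightarrow>\<^sub>E I" for \<sigma> I f
    using that by (intro diagonal_word_closed) (auto simp: PiE_def Pi_iff)
  have inner: "(\<Oplus>f\<in>{..m} \<rightarrow>\<^sub>E I. diagonal_word A m f \<sigma>) \<in> carrier R" if "\<sigma> \<in> ?P" "I \<in> ?C" for \<sigma> I
    using that word by (intro finsum_closed funcsetI)
  have Q: "Q \<sigma> \<in> carrier R" if "\<sigma> \<in> ?P" for \<sigma>
    unfolding Q_def by (rule finsum_closed, rule funcsetI, rule inner[OF that])
  have sgn: "(\<Oplus>\<sigma>\<in>?Pp True. Q \<sigma>) = (\<Oplus>\<sigma>\<in>?Pp True. [sign \<sigma>] \<cdot> Q \<sigma>)"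
    "(\<ominus> (\<Oplus>\<sigma>\<in>?Pp False. Q \<sigma>)) = (\<Oplus>\<sigma>\<in>?Pp False. [sign \<sigma>] \<cdot> Q \<sigma>)"
     using Q by (auto simp: finsum_a_inv[symmetric] Pi_iff sign_def add.int_pow_neg intro!: finsum_cong')
  have "(\<Oplus>\<sigma>\<in>?Pp True. Q \<sigma>) \<ominus> (\<Oplus>\<sigma>\<in>?Pp False. Q \<sigma>) = (\<Oplus>\<sigma>\<in>?Pp True \<union> ?Pp False. [sign \<sigma>] \<cdot> Q \<sigma>)"
    unfolding a_minus_def sgn using Q fin
    by (intro finsum_Un_disjoint[symmetric]) (auto intro!: add.int_pow_closed)
  also have "?Pp True \<union> ?Pp False = ?P" by auto
  also have "(\<Oplus>\<sigma>\<in>?P. [sign \<sigma>] \<cdot> Q \<sigma>)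
      = (\<Oplus>\<sigma>\<in>?P. \<Oplus>I\<in>?C. \<Oplus>f\<in>{..m} \<rightarrow>\<^sub>E I. [sign \<sigma>] \<cdot> diagonal_word A m f \<sigma>)"
  proof (rule finsum_cong')
    fix \<sigma> assume \<sigma>: "\<sigma> \<in> ?P"
    have "[sign \<sigma>] \<cdot> Q \<sigma> = (\<Oplus>I\<in>?C. [sign \<sigma>] \<cdot> (\<Oplus>f\<in>{..m} \<rightarrow>\<^sub>E I. diagonal_word A m f \<sigma>))"
      unfolding Q_def using inner \<sigma> by (intro int_smult_finsum) auto
    also have "\<dots> = (\<Oplus>I\<in>?C. \<Oplus>f\<in>{..m} \<rightarrow>\<^sub>E I. [sign \<sigma>] \<cdot> diagonal_word A m f \<sigma>)"
      using word \<sigma> by (intro finsum_cong' int_smult_finsum) (auto intro!: finsum_closed add.int_pow_closed)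
    finally show "[sign \<sigma>] \<cdot> Q \<sigma> = \<dots>" .
  qed (use word in \<open>auto intro!: finsum_closed add.int_pow_closed\<close>)
  also have "\<dots> = (\<Oplus>I\<in>?C. \<Oplus>\<sigma>\<in>?P. \<Oplus>f\<in>{..m} \<rightarrow>\<^sub>E I. [sign \<sigma>] \<cdot> diagonal_word A m f \<sigma>)"
    using fin word by (intro finsum_swap) (auto intro!: finsum_closed add.int_pow_closed)
  also have "\<dots> = (\<Oplus>I\<in>?C. \<Oplus>f\<in>{..m} \<rightarrow>\<^sub>E I. alternating_sum A m f)"
    unfolding alternating_sum_def using fin word
    by (intro finsum_cong' finsum_swap) (auto intro!: finsum_closed add.int_pow_closed)
  finally show ?thesis
    unfolding subdiagonal_sum[OF k] Q_def .
qed

text \<open>A word using all rows but one occurs once for length \<open>n - 1\<close> and once for length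
  \<open>n\<close>, so only the words using every row survive in the difference.\<close>

lemma subdiagonal_sums_total:
  defines "S \<equiv> \<lambda>p k. \<Oplus>l\<in>subdiagonals p (Suc m) k. pos_power R (su R A l) (Suc m)"
  shows "S True m \<ominus> S False m \<oplus> S False (Suc m) \<ominus> S True (Suc m)
       = \<ominus> (\<Oplus>f\<in>{f \<in> {..m} \<rightarrow>\<^sub>E {..m}. f ` {..m} = {..m}}. alternating_sum A m f)"
proof -
  let ?C = "{I. I \<subseteq> {..m} \<and> card I = m}"
  let ?E = "{..m} \<rightarrow>\<^sub>E {..m}"
  \<comment> \<open>With \<open>m + 1\<close> rows in total, \<open>?F\<close> holds the words that
    use every row and \<open>?F'\<close> those that miss exactly one.\<close>
  let ?F = "{f \<in> ?E. f ` {..m} = {..m}}"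
  let ?F' = "{f \<in> ?E. card (f ` {..m}) = m}"
  let ?U = "alternating_sum A m"
  have finE: "finite ?E" by (intro finite_PiE) auto
  have C: "finite ?C" "I \<in> ?C \<Longrightarrow> finite ({..m} \<rightarrow>\<^sub>E I)" for I
    by (auto intro: finite_PiE dest: finite_subset)
  have U: "?U f \<in> carrier R" if "f \<in> ?E" for f
    using that by (intro alternating_sum_closed) (auto simp: PiE_def)
  \<comment> \<open>Fewer than \<open>m\<close> of the \<open>m + 1\<close> rows occur, so two
    distinct rows are absent and \<open>alternating_sum_eq_zero\<close> applies.\<close>
  have zero: "?U f = \<zero>" if "f \<in> ?E" "card (f ` {..m}) < m" for f
  proof -
    have img: "f ` {..m} \<subseteq> {..m}" using that(1) by auto
    have "1 < card ({..m} - f ` {..m})"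
      using that(2) img by (subst card_Diff_subset) auto
    then obtain i j where "i \<in> {..m} - f ` {..m}" "j \<in> {..m} - f ` {..m}" "i \<noteq> j"
      by (metis One_nat_def card_le_Suc0_iff_eq finite_Diff finite_atMost leD)
    with that(1) show ?thesis
      by (intro alternating_sum_eq_zero[of f i j]) (auto simp: PiE_def)
  qed
  have C_Suc: "{I. I \<subseteq> {..m} \<and> card I = Suc m} = {{..m}}"
    using card_subset_eq[of "{..m}"] by auto
  have SE: "S p k \<in> carrier R" if "k = m \<or> k = Suc m" for p k
    unfolding S_def subdiagonal_sum[OF that]
    by (intro finsum_closed funcsetI diagonal_word_closed) (auto simp: PiE_def Pi_iff)
  have card_cases: "f ` {..m} = {..m} \<or> card (f ` {..m}) = m \<or> card (f ` {..m}) < m" if "f \<in> ?E" for f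
  proof -
    have "f ` {..m} \<subseteq> {..m}" using that by auto
    then show ?thesis
      by (metis card_atMost card_subset_eq card_mono finite_atMost le_Suc_eq le_neq_implies_less)
  qed
  have "S True (Suc m) \<ominus> S False (Suc m) = (\<Oplus>I\<in>{{..m}}. \<Oplus>f\<in>{..m} \<rightarrow>\<^sub>E I. ?U f)"
    unfolding S_def by (subst subdiagonal_sum_diff) (simp_all only: C_Suc disj_not1 simp_thms)
  also have "\<dots> = (\<Oplus>f\<in>?E. ?U f)"
    using U by (simp add: Pi_iff)
  also have "\<dots> = (\<Oplus>f\<in>?F \<union> ?F'. ?U f)"
  proof (rule add.finprod_mono_neutral_cong_right[OF finE])
    fix f assume f: "f \<in> ?E - (?F \<union> ?F')"
    then show "?U f = \<zero>"
      using card_cases[of f] by (intro zero) blast+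
  qed (use U in auto)
  also have "\<dots> = (\<Oplus>f\<in>?F. ?U f) \<oplus> (\<Oplus>f\<in>?F'. ?U f)"
    using finE U by (intro finsum_Un_disjoint) auto
  finally have full: "S True (Suc m) \<ominus> S False (Suc m) = \<dots>" .
  \<comment> \<open>For \<open>m = 0\<close> the only \<open>I\<close> is empty and admits no
    function from \<open>{..0}\<close>; both this sum and the one over \<open>?F'\<close> are then
    empty.\<close>
  have "S True m \<ominus> S False m = (\<Oplus>I\<in>?C. \<Oplus>f\<in>{..m} \<rightarrow>\<^sub>E I. ?U f)"
    unfolding S_def by (subst subdiagonal_sum_diff) auto
  also have "\<dots> = (\<Oplus>I\<in>?C. \<Oplus>f\<in>{f \<in> ?E. f ` {..m} = I}. ?U f)"
  proof (rule finsum_cong')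
    fix I assume I: "I \<in> ?C"
    \<comment> \<open>A word with rows in \<open>I\<close> that does not use all of \<open>I\<close>
      misses a second row, so it contributes zero.\<close>
    have *: "card (f ` {..m}) < m" "f \<in> ?E" if "f \<in> ({..m} \<rightarrow>\<^sub>E I) - {f \<in> ?E. f ` {..m} = I}" for f
    proof -
      show "f \<in> ?E" using that I by (auto simp: PiE_def Pi_iff)
      have "f ` {..m} \<subset> I" using that I \<open>f \<in> ?E\<close> by auto
      then show "card (f ` {..m}) < m" using I by (metis (mono_tags) finite_atMost finite_subset mem_Collect_eq psubset_card_mono)
    qed
    show "(\<Oplus>f\<in>{..m} \<rightarrow>\<^sub>E I. ?U f) = (\<Oplus>f\<in>{f \<in> ?E. f ` {..m} = I}. ?U f)"
    proof (rule add.finprod_mono_neutral_cong_right[OF C(2)[OF I]])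
      show "{f \<in> ?E. f ` {..m} = I} \<subseteq> {..m} \<rightarrow>\<^sub>E I"
        by (auto simp: PiE_def)
      show "?U f = \<zero>" if "f \<in> ({..m} \<rightarrow>\<^sub>E I) - {f \<in> ?E. f ` {..m} = I}" for f
        using * that by (intro zero)
      show "?U \<in> ({..m} \<rightarrow>\<^sub>E I) \<rightarrow> carrier R"
        using I by (intro funcsetI U) (auto simp: PiE_def Pi_iff)
    qed simp
  qed (auto intro!: finsum_closed U)
  \<comment> \<open>The image of a word determines \<open>I\<close>, so the index sets are
    disjoint.\<close>
  also have "\<dots> = (\<Oplus>f\<in>(\<Union>I\<in>?C. {f \<in> ?E. f ` {..m} = I}). ?U f)"
    using C(1) finE U by (intro add.finprod_UN_disjoint[symmetric]) (auto simp: pairwise_def disjnt_def)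
  also have "(\<Union>I\<in>?C. {f \<in> ?E. f ` {..m} = I}) = ?F'"
    by auto
  finally have short: "S True m \<ominus> S False m = (\<Oplus>f\<in>?F'. ?U f)" .
  have F: "(\<Oplus>f\<in>?F. ?U f) \<in> carrier R" "(\<Oplus>f\<in>?F'. ?U f) \<in> carrier R"
    using U by (auto intro!: finsum_closed)
  have "S True m \<ominus> S False m \<oplus> S False (Suc m) \<ominus> S True (Suc m)
      = (S True m \<ominus> S False m) \<oplus> \<ominus> (S True (Suc m) \<ominus> S False (Suc m))"
    using SE by (simp add: a_minus_def minus_add a_ac)
  \<comment> \<open>The sums over \<open>?F'\<close> in \<open>full\<close> and \<open>short\<close>
    cancel.\<close>
  also have "\<dots> = \<ominus> (\<Oplus>f\<in>?F. ?U f)"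
    unfolding full short using F
    by (simp add: minus_add a_lcomm[of _ "\<ominus> (\<Oplus>f\<in>?F. ?U f)"] r_neg)
  finally show ?thesis .
qed

end

end

section \<open>The symmetrized determinant\<close>

lemma transpose_matrices_over:
  "A \<in> matrices_over K n \<Longrightarrow> transpose_mat A \<in> matrices_over K n"
  by (auto simp: matrices_over_def)

lemma transpose_index_matrices_over:
  "A \<in> matrices_over K n \<Longrightarrow> i < n \<Longrightarrow> j < n \<Longrightarrow> transpose_mat A $$ (i, j) = A $$ (j, i)"
  by (auto simp: matrices_over_def)

lemma swaprows_matrices_over:
  "A \<in> matrices_over K n \<Longrightarrow> k < n \<Longrightarrow> l < n \<Longrightarrow> swaprows k l A \<in> matrices_over K n"
  by (auto simp: matrices_over_def)

context divisible_ring
begin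

definition permutation_word :: "'a mat \<Rightarrow> nat \<Rightarrow> (nat \<Rightarrow> nat) \<Rightarrow> (nat \<Rightarrow> nat) \<Rightarrow> 'a" where
  "permutation_word A n \<tau> \<rho> = word_prod R (\<lambda>k. A $$ (\<tau> k, \<rho> k)) (n - 1)"

text \<open>\<open>\<tau>\<close> orders the rows and \<open>\<rho>\<close> the columns of a word.
  Over a commutative ring a word depends only on \<open>\<rho>\<close> after the inverse of
  \<open>\<tau>\<close>, and this is \<open>n!\<close> times the usual determinant.\<close>

definition symmetrized_det :: "'a mat \<Rightarrow> nat \<Rightarrow> 'a" where
  "symmetrized_det A n =
     (\<Oplus>\<tau>\<in>{\<tau>. \<tau> permutes {..<n}}. \<Oplus>\<rho>\<in>{\<rho>. \<rho> permutes {..<n}}.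
        [(sign \<tau> * sign \<rho>)] \<cdot> permutation_word A n \<tau> \<rho>)"

lemma permutation_word_closed:
  assumes "A \<in> matrices_over R n" "n \<ge> 1" "\<tau> permutes {..<n}" "\<rho> permutes {..<n}"
  shows "permutation_word A n \<tau> \<rho> \<in> carrier R"
  unfolding permutation_word_def
proof (intro word_prod_closed matrices_over_entry[OF assms(1)])
  fix k assume "k \<le> n - 1"
  then have "k \<in> {..<n}" using assms(2) by auto
  then show "\<tau> k < n" "\<rho> k < n"
    using permutes_in_image[OF assms(3)] permutes_in_image[OF assms(4)] by auto
qed

lemma symmetrized_det_closed:
  "A \<in> matrices_over R n \<Longrightarrow> n \<ge> 1 \<Longrightarrow> symmetrized_det A n \<in> carrier R"
  unfolding symmetrized_det_def
  by (auto intro!: finsum_closed add.int_pow_closed permutation_word_closed)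

text \<open>Substitute \<open>\<rho> = \<sigma> \<circ> \<tau>\<close>; the signs agree because
  \<open>sign \<tau>\<close> squares to one.\<close>

lemma alternating_sum_permutation:
  assumes A: "A \<in> matrices_over R (Suc m)" and \<tau>: "\<tau> permutes {..<Suc m}"
  shows "alternating_sum A m (restrict \<tau> {..m}) =
    (\<Oplus>\<rho>\<in>{\<rho>. \<rho> permutes {..<Suc m}}. [(sign \<tau> * sign \<rho>)] \<cdot> permutation_word A (Suc m) \<tau> \<rho>)"
proof -
  let ?P = "{\<rho>. \<rho> permutes {..<Suc m}}"
  have closed: "[(sign \<tau> * sign \<rho>)] \<cdot> permutation_word A (Suc m) \<tau> \<rho> \<in> carrier R" if "\<rho> \<in> ?P" for \<rho>
    using that A \<tau> by (auto intro!: add.int_pow_closed permutation_word_closed)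
  have word: "diagonal_word A m (restrict \<tau> {..m}) \<sigma> = permutation_word A (Suc m) \<tau> (\<sigma> \<circ> \<tau>)" for \<sigma>
    unfolding diagonal_word_def permutation_word_def by (auto intro!: word_prod_cong)
  have "(\<Oplus>\<rho>\<in>?P. [(sign \<tau> * sign \<rho>)] \<cdot> permutation_word A (Suc m) \<tau> \<rho>)
      = (\<Oplus>\<sigma>\<in>?P. [(sign \<tau> * sign (\<sigma> \<circ> \<tau>))] \<cdot> permutation_word A (Suc m) \<tau> (\<sigma> \<circ> \<tau>))"
    by (subst image_comp_permutes_right[OF \<tau>, symmetric], rule finsum_reindex,
        unfold image_comp_permutes_right[OF \<tau>])
       (use closed inj_on_comp_permutes_right[OF \<tau>] in auto)
  also have "\<dots> = (\<Oplus>\<sigma>\<in>?P. [sign \<sigma>] \<cdot> diagonal_word A m (restrict \<tau> {..m}) \<sigma>)"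
  proof (rule finsum_cong')
    fix \<sigma> assume "\<sigma> \<in> ?P"
    then show "[(sign \<tau> * sign (\<sigma> \<circ> \<tau>))] \<cdot> permutation_word A (Suc m) \<tau> (\<sigma> \<circ> \<tau>)
             = [sign \<sigma>] \<cdot> diagonal_word A m (restrict \<tau> {..m}) \<sigma>"
      using \<tau> by (simp add: word sign_comp_permutes mult.left_commute[of _ "sign \<sigma>"])
  next
    show "(\<lambda>\<sigma>. [sign \<sigma>] \<cdot> diagonal_word A m (restrict \<tau> {..m}) \<sigma>) \<in> ?P \<rightarrow> carrier R"
      unfolding word using A \<tau>
      by (auto intro!: add.int_pow_closed permutation_word_closed permutes_compose)
  qed simp
  finally show ?thesis
    unfolding alternating_sum_def by simp
qed

text \<open>A surjection of the finite set \<open>{..m}\<close> onto itself is bijective, and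
  extending it by the identity gives a permutation. So the surviving row patterns are exactly the
  permutations.\<close>

lemma restrict_permutes_image:
  "(\<lambda>\<tau>. restrict \<tau> {..m}) ` {\<tau>. \<tau> permutes {..<Suc m}}
     = {f \<in> {..m} \<rightarrow>\<^sub>E {..m}. f ` {..m} = {..m}}" (is "?r ` ?P = ?F")
proof (intro equalityI subsetI)
  fix f assume "f \<in> ?r ` ?P"
  then obtain \<tau> where \<tau>: "\<tau> permutes {..m}" "f = ?r \<tau>"
    by (auto simp: lessThan_Suc_atMost)
  then show "f \<in> ?F"
    using permutes_image[OF \<tau>(1)] by auto
next
  fix f assume f: "f \<in> ?F"
  define \<tau> where "\<tau> k = (if k \<in> {..m} then f k else k)" for k
  have "bij_betw f {..m} {..m}"
    using f by (auto simp: bij_betw_def intro!: eq_card_imp_inj_on)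
  then have "bij_betw \<tau> {..m} {..m}"
    by (subst bij_betw_cong[of _ _ f]) (auto simp: \<tau>_def)
  then have "\<tau> permutes {..<Suc m}"
    unfolding lessThan_Suc_atMost by (rule bij_imp_permutes) (auto simp: \<tau>_def)
  moreover have "f = ?r \<tau>"
    using f by (intro extensionalityI[of _ "{..m}"]) (auto simp: \<tau>_def PiE_def)
  ultimately show "f \<in> ?r ` ?P" by auto
qed

lemma inj_on_restrict_permutes:
  "inj_on (\<lambda>\<tau>. restrict \<tau> {..m}) {\<tau>. \<tau> permutes {..<Suc m}}"
proof (rule inj_onI; clarify)
  fix \<sigma> \<tau> assume *: "\<sigma> permutes {..<Suc m}" "\<tau> permutes {..<Suc m}"
    and eq: "restrict \<sigma> {..m} = restrict \<tau> {..m}"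
  show "\<sigma> = \<tau>"
  proof
    show "\<sigma> k = \<tau> k" for k
      using fun_cong[OF eq, of k] * by (cases "k \<le> m") (auto simp: permutes_def)
  qed
qed

text \<open>The bracket in the definition of \<open>edet\<close> equals minus
  \<open>symmetrized_det\<close> by \<open>subdiagonal_sums_total\<close>, and the outer minus sign
  undoes this.\<close>

lemma
  assumes A: "A \<in> matrices_over R n" and n: "n \<ge> 1"
  shows edet_closed: "edet R A \<in> carrier R"
    and fact_smult_edet: "[(fact n :: int)] \<cdot> edet R A = symmetrized_det A n"
proof -
  obtain m where m: "n = Suc m"
    using n by (cases n) auto
  note A' = A[unfolded m]
  have dim: "dim_row A = Suc m"
    using A m by (auto simp: matrices_over_def)
  let ?F = "{f \<in> {..m} \<rightarrow>\<^sub>E {..m}. f ` {..m} = {..m}}"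
  have "(\<Oplus>f\<in>?F. alternating_sum A m f)
      = (\<Oplus>\<tau>\<in>{\<tau>. \<tau> permutes {..<Suc m}}. alternating_sum A m (restrict \<tau> {..m}))"
    unfolding restrict_permutes_image[symmetric]
    by (rule finsum_reindex[OF _ inj_on_restrict_permutes], unfold restrict_permutes_image)
       (auto intro!: alternating_sum_closed[OF A'] simp: PiE_def)
  also have "\<dots> = symmetrized_det A n"
    unfolding symmetrized_det_def m
    by (intro finsum_cong' alternating_sum_permutation[OF A'])
       (auto intro!: finsum_closed add.int_pow_closed permutation_word_closed[OF A'])
  finally have total: "edet R A = \<ominus> int_divide R (fact n) (\<ominus> symmetrized_det A n)"
    unfolding edet_def dim Let_def using subdiagonal_sums_total[OF A'] by (simp add: m)
  have D: "symmetrized_det A n \<in> carrier R"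
    by (rule symmetrized_det_closed[OF A n])
  then have div: "int_divide R (fact n) (\<ominus> symmetrized_det A n) \<in> carrier R"
    by (intro int_divide_closed) auto
  then show "edet R A \<in> carrier R"
    unfolding total by simp
  have "[(fact n :: int)] \<cdot> edet R A = \<ominus> ([(fact n :: int)] \<cdot> int_divide R (fact n) (\<ominus> symmetrized_det A n))"
    unfolding total using div by (simp add: add.int_pow_inv)
  also have "\<dots> = symmetrized_det A n"
    using D by (subst int_smult_int_divide) auto
  finally show "[(fact n :: int)] \<cdot> edet R A = symmetrized_det A n" .
qed

text \<open>Multiplication by \<open>n!\<close> is injective, so \<open>edet\<close> is
  characterized by this equation and the proofs below can work with \<open>symmetrized_det\<close>
  alone.\<close>

lemma edet_eqI:
  assumes "A \<in> matrices_over R n" "n \<ge> 1" "x \<in> carrier R"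
    and "[(fact n :: int)] \<cdot> x = symmetrized_det A n"
  shows "edet R A = x"
  by (rule int_smult_cancel[of "fact n"]) (use assms in \<open>auto intro: edet_closed simp: fact_smult_edet\<close>)

text \<open>Transposing the matrix exchanges the roles of \<open>\<tau>\<close> and
  \<open>\<rho>\<close>, in which \<open>symmetrized_det\<close> is symmetric.\<close>

lemma edet_transpose:
  assumes A: "A \<in> matrices_over R n" and n: "n \<ge> 1"
  shows "edet R (transpose_mat A) = edet R A"
proof (rule edet_eqI[OF transpose_matrices_over[OF A] n edet_closed[OF A n]])
  let ?P = "{\<sigma>. \<sigma> permutes {..<n}}"
  have *: "permutation_word (transpose_mat A) n \<tau> \<rho> = permutation_word A n \<rho> \<tau>"
    if "\<tau> \<in> ?P" "\<rho> \<in> ?P" for \<tau> \<rho>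
    unfolding permutation_word_def
  proof (rule word_prod_cong)
    fix k assume "k \<le> n - 1"
    then have "k \<in> {..<n}" using n by auto
    then have "\<tau> k < n" "\<rho> k < n"
      using that permutes_in_image[of \<tau> "{..<n}" k] permutes_in_image[of \<rho> "{..<n}" k] by auto
    then show "transpose_mat A $$ (\<tau> k, \<rho> k) = A $$ (\<rho> k, \<tau> k)"
      by (rule transpose_index_matrices_over[OF A])
  qed
  have "symmetrized_det A n = (\<Oplus>\<rho>\<in>?P. \<Oplus>\<tau>\<in>?P. [(sign \<tau> * sign \<rho>)] \<cdot> permutation_word A n \<tau> \<rho>)"
    unfolding symmetrized_det_def
    by (rule finsum_swap) (auto intro!: finite_permutations add.int_pow_closed permutation_word_closed[OF A n])
  also have "\<dots> = symmetrized_det (transpose_mat A) n"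
    unfolding symmetrized_det_def
    by (intro finsum_cong')
       (auto simp: * mult.commute intro!: finsum_closed add.int_pow_closed permutation_word_closed[OF A n])
  finally show "[(fact n :: int)] \<cdot> edet R A = symmetrized_det (transpose_mat A) n"
    using fact_smult_edet[OF A n] by simp
qed

text \<open>A permutation \<open>\<tau>\<close> visits row \<open>r\<close> at exactly one position,
  so every word has exactly one factor from that row and is additive in it.\<close>

lemma edet_add_row:
  assumes A: "A \<in> matrices_over R n" and B: "B \<in> matrices_over R n" and C: "C \<in> matrices_over R n"
    and r: "r < n" and sum: "\<And>j. j < n \<Longrightarrow> C $$ (r, j) = A $$ (r, j) \<oplus> B $$ (r, j)"
    and other: "\<And>i j. i < n \<Longrightarrow> j < n \<Longrightarrow> i \<noteq> r \<Longrightarrow> A $$ (i, j) = C $$ (i, j) \<and> B $$ (i, j) = C $$ (i, j)"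
  shows "edet R C = edet R A \<oplus> edet R B"
proof -
  have n: "n \<ge> 1" using r by simp
  let ?P = "{\<sigma>. \<sigma> permutes {..<n}}"
  note closed = permutation_word_closed[OF A n] permutation_word_closed[OF B n]
    permutation_word_closed[OF C n]
  have word: "permutation_word C n \<tau> \<rho> = permutation_word A n \<tau> \<rho> \<oplus> permutation_word B n \<tau> \<rho>"
    if "\<tau> \<in> ?P" "\<rho> \<in> ?P" for \<tau> \<rho>
  proof -
    have lt: "\<tau> k < n" "\<rho> k < n" if "k \<le> n - 1" for k
      using that n \<open>\<tau> \<in> ?P\<close> \<open>\<rho> \<in> ?P\<close> permutes_in_image[of \<tau> "{..<n}" k] permutes_in_image[of \<rho> "{..<n}" k]
      by auto
    have \<tau>: "inj \<tau>" "surj \<tau>"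
      using that(1) by (simp_all add: permutes_inj[of _ "{..<n}"] permutes_surj[of _ "{..<n}"])
    obtain k where k: "\<tau> k = r"
      using surjE[OF \<tau>(2)] by metis
    then have "k < n"
      using that(1) r permutes_in_image[of \<tau> "{..<n}" k] by auto
    have \<tau>_other: "\<tau> j \<noteq> r" if "j \<noteq> k" for j
      using that k injD[OF \<tau>(1)] by metis
    show ?thesis
      unfolding permutation_word_def
    proof (rule word_prod_add[of k])
      show le: "k \<le> n - 1" using \<open>k < n\<close> by simp
      show "C $$ (\<tau> k, \<rho> k) = A $$ (\<tau> k, \<rho> k) \<oplus> B $$ (\<tau> k, \<rho> k)"
        unfolding k by (rule sum) (rule lt[OF le])
    qed (use lt \<tau>_other in \<open>auto simp: other intro!: matrices_over_entry[OF A] matrices_over_entry[OF B]\<close>)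
  qed
  have "symmetrized_det C n = (\<Oplus>\<tau>\<in>?P. \<Oplus>\<rho>\<in>?P. [(sign \<tau> * sign \<rho>)] \<cdot> permutation_word A n \<tau> \<rho> \<oplus>
      [(sign \<tau> * sign \<rho>)] \<cdot> permutation_word B n \<tau> \<rho>)"
    unfolding symmetrized_det_def
    by (intro finsum_cong') (auto simp: word closed add.int_pow_distrib intro!: finsum_closed add.int_pow_closed)
  also have "\<dots> = (\<Oplus>\<tau>\<in>?P. (\<Oplus>\<rho>\<in>?P. [(sign \<tau> * sign \<rho>)] \<cdot> permutation_word A n \<tau> \<rho>) \<oplus>
      (\<Oplus>\<rho>\<in>?P. [(sign \<tau> * sign \<rho>)] \<cdot> permutation_word B n \<tau> \<rho>))"
    by (intro finsum_cong' finsum_addf) (auto simp: closed intro!: finsum_closed add.int_pow_closed)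
  also have "\<dots> = symmetrized_det A n \<oplus> symmetrized_det B n"
    unfolding symmetrized_det_def
    by (intro finsum_addf) (auto simp: closed intro!: finsum_closed add.int_pow_closed)
  finally show ?thesis
    using A B C n by (intro edet_eqI[of _ n]) (auto simp: edet_closed fact_smult_edet add.int_pow_distrib)
qed

text \<open>A zero row is the sum of itself with itself, so additivity with all three matrices equal
  to \<open>A\<close> gives \<open>x = x + x\<close> for \<open>x = edet A\<close>.\<close>

lemma edet_zero_row:
  assumes A: "A \<in> matrices_over R n" and "i < n" "\<And>j. j < n \<Longrightarrow> A $$ (i, j) = \<zero>"
  shows "edet R A = \<zero>"
proof -
  have "edet R A = edet R A \<oplus> edet R A"
    by (rule edet_add_row[OF A A A \<open>i < n\<close>]) (use assms in auto)
  then show ?thesis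
    using edet_closed[OF A] \<open>i < n\<close> by (simp add: add.l_cancel_one')
qed

text \<open>Interchanging rows amounts to composing \<open>\<tau>\<close> with a transposition on
  the left, which flips its sign.\<close>

lemma edet_swaprows:
  assumes A: "A \<in> matrices_over R n" and kl: "k < n" "l < n" "k \<noteq> l"
  shows "edet R (swaprows k l A) = \<ominus> edet R A"
proof -
  have n: "n \<ge> 1" using kl by simp
  let ?P = "{\<sigma>. \<sigma> permutes {..<n}}"
  let ?t = "transpose k l"
  let ?B = "swaprows k l A"
  have B: "?B \<in> matrices_over R n"
    using A kl by (intro swaprows_matrices_over)
  have t: "?t permutes {..<n}"
    using kl by (intro transpose_permutes)
  note closed = permutation_word_closed[OF A n] permutation_word_closed[OF B n]
  have word: "permutation_word ?B n (?t \<circ> \<tau>) \<rho> = permutation_word A n \<tau> \<rho>"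
    if "\<tau> \<in> ?P" "\<rho> \<in> ?P" for \<tau> \<rho>
    unfolding permutation_word_def
  proof (rule word_prod_cong)
    fix j assume "j \<le> n - 1"
    then have "\<tau> j < n" "\<rho> j < n"
      using that n permutes_in_image[of \<tau> "{..<n}" j] permutes_in_image[of \<rho> "{..<n}" j] by auto
    then show "?B $$ ((?t \<circ> \<tau>) j, \<rho> j) = A $$ (\<tau> j, \<rho> j)"
      using A kl by (auto simp: matrices_over_def transpose_def)
  qed
  let ?g = "\<lambda>\<tau>. \<Oplus>\<rho>\<in>?P. [(sign \<tau> * sign \<rho>)] \<cdot> permutation_word ?B n \<tau> \<rho>"
  have g: "?g \<tau> \<in> carrier R" if "\<tau> \<in> ?P" for \<tau>
    using that by (auto simp: closed intro!: finsum_closed add.int_pow_closed)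
  have "symmetrized_det ?B n = (\<Oplus>\<tau>\<in>?P. ?g (?t \<circ> \<tau>))"
    unfolding symmetrized_det_def
    \<comment> \<open>Only the outer index set is to be rewritten; the inner sum over
      \<open>\<rho>\<close> ranges over the same set and stays.\<close>
    by (subst (1) image_comp_permutes_left[OF t, symmetric], rule finsum_reindex,
        unfold image_comp_permutes_left[OF t])
       (use g inj_on_comp_permutes_left[OF t] in auto)
  also have "\<dots> = (\<Oplus>\<tau>\<in>?P. \<Oplus>\<rho>\<in>?P. \<ominus> ([(sign \<tau> * sign \<rho>)] \<cdot> permutation_word A n \<tau> \<rho>))"
    by (intro finsum_cong')
       (auto simp: word closed sign_comp_permutes[OF t] sign_swap_id kl add.int_pow_neg
          intro!: finsum_closed add.int_pow_closed add.inv_closed)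
  also have "\<dots> = (\<Oplus>\<tau>\<in>?P. \<ominus> (\<Oplus>\<rho>\<in>?P. [(sign \<tau> * sign \<rho>)] \<cdot> permutation_word A n \<tau> \<rho>))"
    by (intro finsum_cong' finsum_a_inv)
       (auto simp: closed intro!: finsum_closed add.int_pow_closed add.inv_closed)
  also have "\<dots> = \<ominus> symmetrized_det A n"
    unfolding symmetrized_det_def
    by (intro finsum_a_inv) (auto simp: closed intro!: finsum_closed add.int_pow_closed)
  finally show ?thesis
    using A B n by (intro edet_eqI[of _ n]) (auto simp: edet_closed fact_smult_edet add.int_pow_inv)
qed

text \<open>Interchanging the equal rows leaves the matrix unchanged, so \<open>edet\<close> equals
  its own negative.\<close>

lemma edet_equal_rows:
  assumes A: "A \<in> matrices_over R n" and kl: "k < n" "l < n" "k \<noteq> l" "row A k = row A l"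
  shows "edet R A = \<zero>"
proof -
  have "row A i $ j = A $$ (i, j)" if "i < n" "j < n" for i j
    using that A by (auto simp: matrices_over_def)
  then have "A $$ (k, j) = A $$ (l, j)" if "j < n" for j
    using that kl by metis
  then have "swaprows k l A = A"
    using A by (intro eq_matI) (auto simp: matrices_over_def)
  then have "edet R A = \<ominus> edet R A"
    using edet_swaprows[OF A kl(1-3)] by simp
  then show ?thesis
    using edet_closed[OF A] kl by (intro eq_a_inv_self_imp_zero) auto
qed

lemma edet_add_col:
  assumes ABC: "A \<in> matrices_over R n" "B \<in> matrices_over R n" "C \<in> matrices_over R n"
    and c: "c < n" and sum: "\<And>i. i < n \<Longrightarrow> C $$ (i, c) = A $$ (i, c) \<oplus> B $$ (i, c)"
    and other: "\<And>i j. i < n \<Longrightarrow> j < n \<Longrightarrow> j \<noteq> c \<Longrightarrow> A $$ (i, j) = C $$ (i, j) \<and> B $$ (i, j) = C $$ (i, j)"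
  shows "edet R C = edet R A \<oplus> edet R B"
proof -
  have "edet R (transpose_mat C) = edet R (transpose_mat A) \<oplus> edet R (transpose_mat B)"
    by (rule edet_add_row[OF ABC[THEN transpose_matrices_over] c])
       (use ABC c sum other in \<open>simp_all add: transpose_index_matrices_over\<close>)
  then show ?thesis
    using ABC c by (simp add: edet_transpose)
qed

lemma edet_zero_col:
  assumes A: "A \<in> matrices_over R n" and "j < n" "\<And>i. i < n \<Longrightarrow> A $$ (i, j) = \<zero>"
  shows "edet R A = \<zero>"
  using edet_zero_row[OF transpose_matrices_over[OF A] \<open>j < n\<close>] assms
  by (simp add: transpose_index_matrices_over edet_transpose)

lemma edet_swapcols:
  assumes A: "A \<in> matrices_over R n" and kl: "k < n" "l < n" "k \<noteq> l"
  shows "edet R (swapcols k l A) = \<ominus> edet R A"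
proof -
  have "A \<in> carrier_mat n n" using A by (simp add: matrices_over_def)
  then have "swapcols k l A = transpose_mat (swaprows k l (transpose_mat A))"
    using kl by (intro swapcols_is_transp_swap_rows)
  then show ?thesis
    using A kl transpose_matrices_over[OF A]
    by (simp add: edet_transpose[of _ n] edet_swaprows[of _ n] swaprows_matrices_over)
qed

lemma edet_equal_cols:
  assumes A: "A \<in> matrices_over R n" and kl: "k < n" "l < n" "k \<noteq> l" "col A k = col A l"
  shows "edet R A = \<zero>"
proof -
  have "dim_col A = n" using A by (auto simp: matrices_over_def)
  then have "edet R (transpose_mat A) = \<zero>"
    using kl by (intro edet_equal_rows[OF transpose_matrices_over[OF A] kl(1-3)]) simp
  then show ?thesis
    using A kl by (simp add: edet_transpose)
qed

end

section \<open>Diagonal matrices of size two and the counterexamples\<close>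

lemma permutes_lessThan_1: "{\<sigma>. \<sigma> permutes {..<1::nat}} = {id}"
proof -
  have "{..<1::nat} = {0}" by auto
  then show ?thesis by simp
qed

lemma permutes_lessThan_2: "{\<sigma>. \<sigma> permutes {..<2::nat}} = {id, transpose 0 1}"
proof -
  have "{..<2::nat} = {0, 1}" by auto
  then show ?thesis by (auto simp: permutes_doubleton_iff permutes_id permutes_swap_id)
qed

context divisible_ring
begin

lemma edet_1:
  assumes "A \<in> matrices_over R 1"
  shows "edet R A = A $$ (0, 0)"
proof (rule edet_eqI[OF assms])
  have entry: "A $$ (0, 0) \<in> carrier R"
    using assms by (intro matrices_over_entry) auto
  then show "[(fact 1 :: int)] \<cdot> A $$ (0, 0) = symmetrized_det A 1"
    by (simp add: symmetrized_det_def permutes_lessThan_1 permutation_word_def Pi_iff del: One_nat_def)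
qed (use assms in \<open>auto intro: matrices_over_entry\<close>)

definition diag2 :: "'a \<Rightarrow> 'a \<Rightarrow> 'a mat" where
  "diag2 x y = mat 2 2 (\<lambda>(i, j). if i = j then if i = 0 then x else y else \<zero>)"

lemma diag2_matrices_over:
  "x \<in> carrier R \<Longrightarrow> y \<in> carrier R \<Longrightarrow> diag2 x y \<in> matrices_over R 2"
  by (auto simp: diag2_def matrices_over_def)

text \<open>Only the words with \<open>\<tau> = \<rho>\<close> avoid the zero entries; they carry
  sign one and list the diagonal in its two possible orders.\<close>

lemma edet_diag2:
  assumes "x \<in> carrier R" "y \<in> carrier R"
  shows "[(2::int)] \<cdot> edet R (diag2 x y) = x \<otimes> y \<oplus> y \<otimes> x"
proof -
  have t: "id \<noteq> transpose 0 (1::nat)"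
    by (metis id_apply transpose_apply_first zero_neq_one)
  have word: "permutation_word (diag2 x y) 2 id id = x \<otimes> y"
    "permutation_word (diag2 x y) 2 (transpose 0 1) (transpose 0 1) = y \<otimes> x"
    "permutation_word (diag2 x y) 2 id (transpose 0 1) = \<zero>"
    "permutation_word (diag2 x y) 2 (transpose 0 1) id = \<zero>"
    using assms by (simp_all add: permutation_word_def diag2_def l_null)
  have "[(2::int)] \<cdot> edet R (diag2 x y) = symmetrized_det (diag2 x y) 2"
    using fact_smult_edet[OF diag2_matrices_over[OF assms]] by (simp add: fact_numeral)
  also have "\<dots> = x \<otimes> y \<oplus> y \<otimes> x"
    unfolding symmetrized_det_def permutes_lessThan_2
    using assms t by (simp add: word sign_swap_id m_closed Pi_iff del: One_nat_def)
  finally show ?thesis .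
qed

text \<open>The minors belonging to the zero entries only have to lie in the carrier, since the
  expansions multiply them by \<open>\<zero>\<close>.\<close>

lemma edet_mat_delete_diag2:
  assumes "x \<in> carrier R" "y \<in> carrier R"
  shows "edet R (mat_delete (diag2 x y) 0 0) = y"
    and "edet R (mat_delete (diag2 x y) 0 1) \<in> carrier R"
    and "edet R (mat_delete (diag2 x y) 1 0) \<in> carrier R"
proof -
  have *: "mat_delete (diag2 x y) i j \<in> matrices_over R 1" for i j
    using assms by (auto simp: matrices_over_def mat_delete_def diag2_def)
  show "edet R (mat_delete (diag2 x y) 0 0) = y"
    by (subst edet_1[OF *]) (simp add: mat_delete_def diag2_def)
  show "edet R (mat_delete (diag2 x y) 0 1) \<in> carrier R"
    "edet R (mat_delete (diag2 x y) 1 0) \<in> carrier R"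
    by (intro edet_closed[OF *]; simp)+
qed

lemma laplace_row_diag2:
  assumes "x \<in> carrier R" "y \<in> carrier R"
  shows "laplace_row R (diag2 x y) 0 = x \<otimes> y"
proof -
  have *: "{..<dim_col (diag2 x y)} = {0, 1}" "diag2 x y $$ (0, 0) = x" "diag2 x y $$ (0, 1) = \<zero>"
    by (auto simp: diag2_def)
  show ?thesis
    unfolding laplace_row_def *(1) using assms edet_mat_delete_diag2[OF assms]
    by (simp add: * l_null m_closed Pi_iff del: One_nat_def)
qed

lemma laplace_col_diag2:
  assumes "x \<in> carrier R" "y \<in> carrier R"
  shows "laplace_col R (diag2 x y) 0 = x \<otimes> y"
proof -
  have *: "{..<dim_row (diag2 x y)} = {0, 1}" "diag2 x y $$ (0, 0) = x" "diag2 x y $$ (1, 0) = \<zero>"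
    by (auto simp: diag2_def)
  show ?thesis
    unfolding laplace_col_def *(1) using assms edet_mat_delete_diag2[OF assms]
    by (simp add: * l_null m_closed Pi_iff del: One_nat_def)
qed

lemma mat_product_diag2:
  assumes "x \<in> carrier R" "y \<in> carrier R" "z \<in> carrier R" "w \<in> carrier R"
  shows "mat_product R (diag2 x y) (diag2 z w) = diag2 (x \<otimes> z) (y \<otimes> w)"
proof -
  have "{..<2::nat} = {0, 1}" by auto
  then show ?thesis
    using assms
    by (intro eq_matI)
       (auto simp: mat_product_def diag2_def less_2_cases_iff l_null r_null m_closed)
qed

lemma int_smult_2: "x \<in> carrier R \<Longrightarrow> [(2::int)] \<cdot> x = x \<oplus> x"
  using add.int_pow_mult[of x 1 1] by simp

text \<open>Doubling either value and comparing with \<open>edet_diag2\<close> leaves the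
  commutation after cancellation. The first alternative serves the Laplace expansions, the second
  multiplicativity.\<close>

lemma commute_if_edet_diag2:
  assumes "x \<in> carrier R" "y \<in> carrier R" "edet R (diag2 x y) = x \<otimes> y \<or> edet R (diag2 x y) = y \<otimes> x"
  shows "x \<otimes> y = y \<otimes> x"
  using edet_diag2[OF assms(1,2)] assms by (auto simp: int_smult_2 m_closed)

lemma edet_diag2_unit:
  assumes "e \<in> carrier R" "x \<in> carrier R" "e \<otimes> x = x" "x \<otimes> e = x"
  shows "edet R (diag2 e x) = x" "edet R (diag2 x e) = x"
proof -
  have "edet R (diag2 e x) \<in> carrier R" "edet R (diag2 x e) \<in> carrier R"
    using assms by (auto intro!: edet_closed[of _ 2] diag2_matrices_over)
  then show "edet R (diag2 e x) = x" "edet R (diag2 x e) = x"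
    using edet_diag2[of e x] edet_diag2[of x e] assms int_smult_2[of x]
    by (simp_all add: int_smult_cancel[of 2 _ x])
qed

text \<open>The matrix product is \<open>diag2 x y\<close>, while the product of the two values of
  \<open>edet\<close> is \<open>y \<otimes> x\<close>, in the reversed order.\<close>

lemma commute_if_edet_mult:
  assumes e: "e \<in> carrier R" "\<And>x. x \<in> carrier R \<Longrightarrow> e \<otimes> x = x \<and> x \<otimes> e = x"
    and xy: "x \<in> carrier R" "y \<in> carrier R"
    and mult: "edet R (mat_product R (diag2 e y) (diag2 x e)) = edet R (diag2 e y) \<otimes> edet R (diag2 x e)"
  shows "x \<otimes> y = y \<otimes> x"
  using commute_if_edet_diag2[OF xy] mult xy e
  by (simp add: mat_product_diag2 edet_diag2_unit)

end

section \<open>A noncommutative ring with unit and division by integers\<close>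

text \<open>The triple \<open>(a, b, c)\<close> stands for the matrix with rows \<open>(a, b)\<close> and \<open>(0, c)\<close>.\<close>

definition upper_mult :: "rat \<times> rat \<times> rat \<Rightarrow> rat \<times> rat \<times> rat \<Rightarrow> rat \<times> rat \<times> rat" where
  "upper_mult = (\<lambda>(a, b, c) (a', b', c'). (a * a', a * b' + b * c', c * c'))"

text \<open>Rational triples are countable, so they are coded by natural numbers to obtain a ring of
  the type \<open>nat ring\<close> over which the negative claims range.\<close>

definition upper_ring :: "nat ring" where
  "upper_ring =
     \<lparr>carrier = range (to_nat :: rat \<times> rat \<times> rat \<Rightarrow> nat),
      mult = (\<lambda>x y. to_nat (upper_mult (from_nat x) (from_nat y))),
      one = to_nat (1 :: rat, 0 :: rat, 1 :: rat),
      zero = to_nat (0 :: rat \<times> rat \<times> rat),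
      add = (\<lambda>x y. to_nat (from_nat x + from_nat y :: rat \<times> rat \<times> rat))\<rparr>"

lemma upper_ring_simps:
  "carrier upper_ring = range (to_nat :: rat \<times> rat \<times> rat \<Rightarrow> nat)"
  "to_nat s \<otimes>\<^bsub>upper_ring\<^esub> to_nat t = to_nat (upper_mult s t)"
  "to_nat (s :: rat \<times> rat \<times> rat) \<oplus>\<^bsub>upper_ring\<^esub> to_nat t = to_nat (s + t)"
  "\<one>\<^bsub>upper_ring\<^esub> = to_nat (1 :: rat, 0 :: rat, 1 :: rat)"
  "\<zero>\<^bsub>upper_ring\<^esub> = to_nat (0 :: rat \<times> rat \<times> rat)"
  by (simp_all add: upper_ring_def)

lemma nonunital_ring_upper_ring: "nonunital_ring upper_ring"
proof (intro nonunital_ring.intro nonunital_ring_axioms.intro abelian_groupI)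
  fix x assume "x \<in> carrier upper_ring"
  then obtain s where "x = to_nat (s :: rat \<times> rat \<times> rat)" by (auto simp: upper_ring_simps)
  then show "\<exists>y\<in>carrier upper_ring. y \<oplus>\<^bsub>upper_ring\<^esub> x = \<zero>\<^bsub>upper_ring\<^esub>"
    by (intro bexI[of _ "to_nat (- s)"]) (auto simp: upper_ring_simps)
qed (auto simp: upper_ring_simps upper_mult_def algebra_simps)

lemma int_smult_upper_ring:
  fixes a b c :: rat
  shows "[(m::int)] \<cdot>\<^bsub>upper_ring\<^esub> to_nat (a, b, c)
       = to_nat (of_int m * a, of_int m * b, of_int m * c)"
proof -
  interpret nonunital_ring upper_ring by (rule nonunital_ring_upper_ring)
  let ?x = "to_nat (a, b, c)"
  have x: "?x \<in> carrier upper_ring" by (auto simp: upper_ring_simps)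
  have nat: "[int k] \<cdot>\<^bsub>upper_ring\<^esub> ?x = to_nat (of_nat k * a, of_nat k * b, of_nat k * c)" for k
  proof (induction k)
    case 0
    show ?case by (simp add: add_pow_def upper_ring_simps zero_prod_def)
  next
    case (Suc k)
    have "[int (Suc k)] \<cdot>\<^bsub>upper_ring\<^esub> ?x = [int k] \<cdot>\<^bsub>upper_ring\<^esub> ?x \<oplus>\<^bsub>upper_ring\<^esub> ?x"
      using add.int_pow_mult[OF x, of "int k" 1] x by (simp add: add.commute)
    then show ?case
      by (simp add: Suc upper_ring_simps algebra_simps)
  qed
  have inv: "\<ominus>\<^bsub>upper_ring\<^esub> to_nat s = to_nat (- s)" for s :: "rat \<times> rat \<times> rat"
    by (rule minus_equality) (auto simp: upper_ring_simps)
  show ?thesis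
  proof (cases m rule: int_cases2)
    case (nonneg k)
    then show ?thesis using nat[of k] by simp
  next
    case (nonpos k)
    then show ?thesis using nat[of k] x by (simp add: add.int_pow_neg inv)
  qed
qed

lemma division_by_integers_upper_ring: "division_by_integers upper_ring"
  unfolding division_by_integers_def
proof (intro allI impI bij_betw_byWitness)
  fix m :: int assume m: "m \<noteq> 0"
  \<comment> \<open>The inverse of multiplication by \<open>m\<close> divides each decoded
    coordinate by \<open>m\<close>.\<close>
  let ?g = "\<lambda>x. case from_nat x of (a, b, c) \<Rightarrow> to_nat (a / of_int m :: rat, b / of_int m :: rat, c / of_int m :: rat)"
  show "\<forall>x\<in>carrier upper_ring. ?g ([m] \<cdot>\<^bsub>upper_ring\<^esub> x) = x"
    "\<forall>x\<in>carrier upper_ring. [m] \<cdot>\<^bsub>upper_ring\<^esub> ?g x = x"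
    "(\<lambda>x. [m] \<cdot>\<^bsub>upper_ring\<^esub> x) ` carrier upper_ring \<subseteq> carrier upper_ring"
    "?g ` carrier upper_ring \<subseteq> carrier upper_ring"
    using m by (auto simp: upper_ring_simps int_smult_upper_ring)
qed

interpretation upper_ring: divisible_ring upper_ring
  by (intro divisible_ring.intro divisible_ring_axioms.intro nonunital_ring_upper_ring
      division_by_integers_upper_ring)

abbreviation "E11 \<equiv> to_nat (1 :: rat, 0 :: rat, 0 :: rat)"
abbreviation "E12 \<equiv> to_nat (0 :: rat, 1 :: rat, 0 :: rat)"

text \<open>For the matrix units, \<open>E11\<close> times \<open>E12\<close> is \<open>E12\<close>,
  while \<open>E12\<close> times \<open>E11\<close> is zero.\<close>

lemma upper_ring_elements:
  "E11 \<in> carrier upper_ring" "E12 \<in> carrier upper_ring" "\<one>\<^bsub>upper_ring\<^esub> \<in> carrier upper_ring"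
  "x \<in> carrier upper_ring \<Longrightarrow> \<one>\<^bsub>upper_ring\<^esub> \<otimes>\<^bsub>upper_ring\<^esub> x = x \<and> x \<otimes>\<^bsub>upper_ring\<^esub> \<one>\<^bsub>upper_ring\<^esub> = x"
  "E11 \<otimes>\<^bsub>upper_ring\<^esub> E12 \<noteq> E12 \<otimes>\<^bsub>upper_ring\<^esub> E11"
  by (auto simp: upper_ring_simps upper_mult_def)

lemma laplace_row_fails:
  "edet upper_ring (upper_ring.diag2 E11 E12) \<noteq> laplace_row upper_ring (upper_ring.diag2 E11 E12) 0"
  using upper_ring.commute_if_edet_diag2[of E11 E12] upper_ring_elements
  by (auto simp: upper_ring.laplace_row_diag2)

lemma laplace_col_fails:
  "edet upper_ring (upper_ring.diag2 E11 E12) \<noteq> laplace_col upper_ring (upper_ring.diag2 E11 E12) 0"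
  using upper_ring.commute_if_edet_diag2[of E11 E12] upper_ring_elements
  by (auto simp: upper_ring.laplace_col_diag2)

text \<open>The unit in opposite corners makes the matrix product the diagonal matrix of
  \<open>E11\<close> and \<open>E12\<close>, whereas the values of \<open>edet\<close> multiply in
  the order \<open>E12\<close>, \<open>E11\<close>.\<close>

lemma edet_mult_fails:
  defines "A \<equiv> upper_ring.diag2 \<one>\<^bsub>upper_ring\<^esub> E12"
    and "B \<equiv> upper_ring.diag2 E11 \<one>\<^bsub>upper_ring\<^esub>"
  shows "edet upper_ring (mat_product upper_ring A B) \<noteq> edet upper_ring A \<otimes>\<^bsub>upper_ring\<^esub> edet upper_ring B"
  unfolding A_def B_def
  using upper_ring.commute_if_edet_mult[of "\<one>\<^bsub>upper_ring\<^esub>" E11 E12] upper_ring_elements by auto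

section \<open>Assembly of the positive and the negative statements\<close>

theorem lemma1:
  fixes K :: "('a, 'm) ring_scheme" and n :: nat
  assumes "nonunital_ring K" and "division_by_integers K" and "n \<ge> 1"
  shows
    "(\<forall>A \<in> matrices_over K n. \<forall>B \<in> matrices_over K n. \<forall>C \<in> matrices_over K n. \<forall>r<n.
        (\<forall>j<n. C $$ (r, j) = A $$ (r, j) \<oplus>\<^bsub>K\<^esub> B $$ (r, j)) \<and>
        (\<forall>i<n. i \<noteq> r \<longrightarrow> row A i = row C i \<and> row B i = row C i)
        \<longrightarrow> edet K C = edet K A \<oplus>\<^bsub>K\<^esub> edet K B) \<and>
     (\<forall>A \<in> matrices_over K n. \<forall>B \<in> matrices_over K n. \<forall>C \<in> matrices_over K n. \<forall>c<n.
        (\<forall>i<n. C $$ (i, c) = A $$ (i, c) \<oplus>\<^bsub>K\<^esub> B $$ (i, c)) \<and>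
        (\<forall>j<n. j \<noteq> c \<longrightarrow> col A j = col C j \<and> col B j = col C j)
        \<longrightarrow> edet K C = edet K A \<oplus>\<^bsub>K\<^esub> edet K B) \<and>
     (\<forall>A \<in> matrices_over K n. \<forall>k<n. \<forall>l<n. k \<noteq> l \<longrightarrow>
        edet K (swaprows k l A) = \<ominus>\<^bsub>K\<^esub> edet K A \<and>
        edet K (swapcols k l A) = \<ominus>\<^bsub>K\<^esub> edet K A) \<and>
     (\<forall>A \<in> matrices_over K n.
        (\<exists>i<n. \<forall>j<n. A $$ (i, j) = \<zero>\<^bsub>K\<^esub>) \<or> (\<exists>j<n. \<forall>i<n. A $$ (i, j) = \<zero>\<^bsub>K\<^esub>)
        \<longrightarrow> edet K A = \<zero>\<^bsub>K\<^esub>) \<and>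
     (\<forall>A \<in> matrices_over K n.
        (\<exists>k<n. \<exists>l<n. k \<noteq> l \<and> (row A k = row A l \<or> col A k = col A l))
        \<longrightarrow> edet K A = \<zero>\<^bsub>K\<^esub>) \<and>
     (\<forall>A \<in> matrices_over K n. edet K A = edet K (transpose_mat A)) \<and>
     \<comment> \<open>The remaining three formulas fail in general. Rings on subsets of \<open>nat\<close> represent all
         countable rings; failure there implies failure over all rings.\<close>
     \<not> (\<forall>(R :: nat ring) m. nonunital_ring R \<and> division_by_integers R \<and> m \<ge> 2 \<longrightarrow>
          (\<forall>A \<in> matrices_over R m. \<forall>i<m. edet R A = laplace_row R A i)) \<and>
     \<not> (\<forall>(R :: nat ring) m. nonunital_ring R \<and> division_by_integers R \<and> m \<ge> 2 \<longrightarrow>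
          (\<forall>A \<in> matrices_over R m. \<forall>j<m. edet R A = laplace_col R A j)) \<and>
     \<not> (\<forall>(R :: nat ring) m. nonunital_ring R \<and> division_by_integers R \<and> m \<ge> 1 \<longrightarrow>
          (\<forall>A \<in> matrices_over R m. \<forall>B \<in> matrices_over R m.
             edet R (mat_product R A B) = edet R A \<otimes>\<^bsub>R\<^esub> edet R B))"

proof -
  interpret divisible_ring K
    by (intro divisible_ring.intro divisible_ring_axioms.intro assms)
  note n = \<open>n \<ge> 1\<close>
  \<comment> \<open>The theorem compares whole rows and columns as vectors, the additivity lemmas
    compare entries.\<close>
  have row_entry: "X $$ (i, j) = Y $$ (i, j)"
    if "X \<in> matrices_over K n" "Y \<in> matrices_over K n" "row X i = row Y i" "i < n" "j < n" for X Y i j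
  proof -
    have "row X i $ j = X $$ (i, j)" "row Y i $ j = Y $$ (i, j)"
      using that(1,2,4,5) by (auto simp: matrices_over_def)
    then show ?thesis using that(3) by simp
  qed
  have col_entry: "X $$ (i, j) = Y $$ (i, j)"
    if "X \<in> matrices_over K n" "Y \<in> matrices_over K n" "col X j = col Y j" "i < n" "j < n" for X Y i j
  proof -
    have "col X j $ i = X $$ (i, j)" "col Y j $ i = Y $$ (i, j)"
      using that(1,2,4,5) by (auto simp: matrices_over_def)
    then show ?thesis using that(3) by simp
  qed
  show ?thesis
  proof (intro conjI)
    show "\<forall>A \<in> matrices_over K n. \<forall>B \<in> matrices_over K n. \<forall>C \<in> matrices_over K n. \<forall>r<n.
        (\<forall>j<n. C $$ (r, j) = A $$ (r, j) \<oplus>\<^bsub>K\<^esub> B $$ (r, j)) \<and>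
        (\<forall>i<n. i \<noteq> r \<longrightarrow> row A i = row C i \<and> row B i = row C i)
        \<longrightarrow> edet K C = edet K A \<oplus>\<^bsub>K\<^esub> edet K B"
    proof (intro ballI allI impI; elim conjE)
      fix A B C r
      assume ABC: "A \<in> matrices_over K n" "B \<in> matrices_over K n" "C \<in> matrices_over K n" and "r < n"
        and "\<forall>j<n. C $$ (r, j) = A $$ (r, j) \<oplus>\<^bsub>K\<^esub> B $$ (r, j)"
        and "\<forall>i<n. i \<noteq> r \<longrightarrow> row A i = row C i \<and> row B i = row C i"
      then show "edet K C = edet K A \<oplus>\<^bsub>K\<^esub> edet K B"
        using row_entry[OF ABC(1,3)] row_entry[OF ABC(2,3)]
        by (intro edet_add_row[OF ABC \<open>r < n\<close>]) blast+
    qed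
    show "\<forall>A \<in> matrices_over K n. \<forall>B \<in> matrices_over K n. \<forall>C \<in> matrices_over K n. \<forall>c<n.
        (\<forall>i<n. C $$ (i, c) = A $$ (i, c) \<oplus>\<^bsub>K\<^esub> B $$ (i, c)) \<and>
        (\<forall>j<n. j \<noteq> c \<longrightarrow> col A j = col C j \<and> col B j = col C j)
        \<longrightarrow> edet K C = edet K A \<oplus>\<^bsub>K\<^esub> edet K B"
    proof (intro ballI allI impI; elim conjE)
      fix A B C c
      assume ABC: "A \<in> matrices_over K n" "B \<in> matrices_over K n" "C \<in> matrices_over K n" and "c < n"
        and "\<forall>i<n. C $$ (i, c) = A $$ (i, c) \<oplus>\<^bsub>K\<^esub> B $$ (i, c)"
        and "\<forall>j<n. j \<noteq> c \<longrightarrow> col A j = col C j \<and> col B j = col C j"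
      then show "edet K C = edet K A \<oplus>\<^bsub>K\<^esub> edet K B"
        using col_entry[OF ABC(1,3)] col_entry[OF ABC(2,3)]
        by (intro edet_add_col[OF ABC \<open>c < n\<close>]) blast+
    qed
    show "\<forall>A \<in> matrices_over K n. \<forall>k<n. \<forall>l<n. k \<noteq> l \<longrightarrow>
        edet K (swaprows k l A) = \<ominus>\<^bsub>K\<^esub> edet K A \<and>
        edet K (swapcols k l A) = \<ominus>\<^bsub>K\<^esub> edet K A"
      using edet_swaprows edet_swapcols by blast
    show "\<forall>A \<in> matrices_over K n.
        (\<exists>i<n. \<forall>j<n. A $$ (i, j) = \<zero>\<^bsub>K\<^esub>) \<or> (\<exists>j<n. \<forall>i<n. A $$ (i, j) = \<zero>\<^bsub>K\<^esub>)
        \<longrightarrow> edet K A = \<zero>\<^bsub>K\<^esub>"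
      using edet_zero_row edet_zero_col by blast
    show "\<forall>A \<in> matrices_over K n.
        (\<exists>k<n. \<exists>l<n. k \<noteq> l \<and> (row A k = row A l \<or> col A k = col A l))
        \<longrightarrow> edet K A = \<zero>\<^bsub>K\<^esub>"
      using edet_equal_rows edet_equal_cols by blast
    show "\<forall>A \<in> matrices_over K n. edet K A = edet K (transpose_mat A)"
      using edet_transpose n by simp
  next
    have mats: "upper_ring.diag2 x y \<in> matrices_over upper_ring 2"
      if "x \<in> {E11, E12, \<one>\<^bsub>upper_ring\<^esub>}" "y \<in> {E11, E12, \<one>\<^bsub>upper_ring\<^esub>}" for x y
      using that upper_ring_elements by (intro upper_ring.diag2_matrices_over) auto
    note witness = nonunital_ring_upper_ring division_by_integers_upper_ring
    show "\<not> (\<forall>(R :: nat ring) m. nonunital_ring R \<and> division_by_integers R \<and> m \<ge> 2 \<longrightarrow>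
          (\<forall>A \<in> matrices_over R m. \<forall>i<m. edet R A = laplace_row R A i))"
      \<comment> \<open>The counterexample has size 2, and the expansion fails along row 0;
        \<open>pos2\<close> shows that this index is admissible.\<close>
      using witness laplace_row_fails mats[of E11 E12] pos2 by blast
    show "\<not> (\<forall>(R :: nat ring) m. nonunital_ring R \<and> division_by_integers R \<and> m \<ge> 2 \<longrightarrow>
          (\<forall>A \<in> matrices_over R m. \<forall>j<m. edet R A = laplace_col R A j))"
      using witness laplace_col_fails mats[of E11 E12] pos2 by blast
    show "\<not> (\<forall>(R :: nat ring) m. nonunital_ring R \<and> division_by_integers R \<and> m \<ge> 1 \<longrightarrow>
          (\<forall>A \<in> matrices_over R m. \<forall>B \<in> matrices_over R m.
             edet R (mat_product R A B) = edet R A \<otimes>\<^bsub>R\<^esub> edet R B))"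
      using witness edet_mult_fails mats[of "\<one>\<^bsub>upper_ring\<^esub>" E12] mats[of E11 "\<one>\<^bsub>upper_ring\<^esub>"] one_le_numeral
      by blast
  qed
qed

end
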